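(* Let $X \subset \mathbb{R}^2$ be a compact real algebraic curve, and let $\{A_\epsilon\}_{\epsilon \searrow 0}$ be a sequence of finite subsets of $X$, indexed by a decreasing sequence of positive real numbers $\epsilon$ tending to $0$, such that each $A_\epsilon$ contains all singular points of $X$ and every point of $X$ is within distance $\epsilon$ of some point of $A_\epsilon$. Then: (1) Every Voronoi cell of $X$ is the Wijsman limit of a sequence of Voronoi cells of the sets $A_\epsilon$; that is, for every $p \in X$ there are points $a_\epsilon \in A_\epsilon$ such that $\mathrm{Vor}_{A_\epsilon}(a_\epsilon)$ is Wijsman convergent to $\mathrm{Vor}_X(p)$ as $\epsilon \searrow 0$. (2) If $X$ is not tangent to any circle in four or more points, then every maximal Delaunay cell of $X$ is the Hausdorff limit of a sequence of Delaunay cells of the sets $A_\epsilon$ (one Delaunay cell of $A_\epsilon$ for each $\epsilon$).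
   Context: A real algebraic variety $X \subset \mathbb{R}^n$ is a nonempty zero locus of a set of polynomials with real coefficients (it may be reducible); it is a curve if it has dimension $1$. $d$ denotes Euclidean distance. Voronoi cells: for $S \subset \mathbb{R}^n$ and $x \in S$, $\mathrm{Vor}_S(x) = \{ y \in \mathbb{R}^n : d(y,x) \le d(y,x') \text{ for all } x' \in S\}$. Delaunay cells: let $B(p,r)$ denote the open disc with center $p \in \mathbb{R}^n$ and radius $r>0$. It is inscribed with respect to $S \subset \mathbb{R}^n$ if $S \cap B(p,r) = \emptyset$. For an inscribed disc $B$ of $S$, the Delaunay cell is $\mathrm{Del}_S(B) = \mathrm{conv}(\overline{B} \cap S)$. A Delaunay cell is maximal if it is not contained in any other Delaunay cell of $S$. These definitions are applied both to $S=X$ and to $S=A_\epsilon$. Wijsman convergence: for $x \in \mathbb{R}^n$ and closed $B \subset \mathbb{R}^n$ put $d_w(x,B) = \inf_{b \in B} d(x,b)$. A sequence of closed sets $B_\nu$ is Wijsman convergent to $B$ if $d_w(x,B_\nu) \to d_w(x,B)$ for every $x \in \mathbb{R}^n$. Hausdorff convergence: for compact sets $B_1,B_2$, $d_h(B_1,B_2) = \sup\{ \sup_{x \in B_1}\inf_{y \in B_2} d(x,y),\ \sup_{y \in B_2}\inf_{x \in B_1} d(x,y)\}$. A sequence of compact sets $B_\nu$ is Hausdorff convergent to $B$ if $d_h(B,B_\nu) \to 0$. *)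

theory Defs
  imports "HOL-Analysis.Analysis" "HOL-Library.Extended_Nat"
begin

definition algebraic_set :: "'a::euclidean_space set \<Rightarrow> bool" where
  "algebraic_set V \<longleftrightarrow>
     (\<exists>F. (\<forall>f\<in>F. real_polynomial_function f) \<and> V = {x. \<forall>f\<in>F. f x = 0})"

definition real_variety :: "'a::euclidean_space set \<Rightarrow> bool" where
  "real_variety X \<longleftrightarrow> algebraic_set X \<and> X \<noteq> {}"

definition irreducible_variety :: "'a::euclidean_space set \<Rightarrow> bool" where
  "irreducible_variety Z \<longleftrightarrow> real_variety Z \<and>
     (\<forall>V W. algebraic_set V \<and> algebraic_set W \<and> Z = V \<union> W \<longrightarrow> Z = V \<or> Z = W)"

text \<open>Krull dimension with respect to the real Zariski topology: the supremum of the lengths \<open>n\<close>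
  of chains \<open>Z 0 \<subset> \<dots> \<subset> Z n\<close> of irreducible subvarieties.\<close>

definition variety_dim :: "'a::euclidean_space set \<Rightarrow> enat" where
  "variety_dim X = Sup {enat n | n. \<exists>Z :: nat \<Rightarrow> 'a set.
     (\<forall>i\<le>n. irreducible_variety (Z i) \<and> Z i \<subseteq> X) \<and> (\<forall>i<n. Z i \<subset> Z (Suc i))}"

definition real_algebraic_curve :: "'a::euclidean_space set \<Rightarrow> bool" where
  "real_algebraic_curve X \<longleftrightarrow> real_variety X \<and> variety_dim X = 1"

definition vanishing_ideal :: "'a::euclidean_space set \<Rightarrow> ('a \<Rightarrow> real) set" where
  "vanishing_ideal X = {f. real_polynomial_function f \<and> (\<forall>x\<in>X. f x = 0)}"

text \<open>The Zariski tangent space at \<open>p\<close>, i.e. the kernel of the Jacobian matrix at \<open>p\<close> of any set of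
  generators of the vanishing ideal. So \<open>p\<close> is nonsingular iff the Jacobian has rank equal to the
  codimension of \<open>X\<close>. In particular, a zero-dimensional component of a curve is a singular point.\<close>

definition tangent_space :: "'a::euclidean_space set \<Rightarrow> 'a \<Rightarrow> 'a set" where
  "tangent_space X p = {v. \<forall>f\<in>vanishing_ideal X. frechet_derivative f (at p) v = 0}"

definition singular_points :: "'a::euclidean_space set \<Rightarrow> 'a set" where
  "singular_points X = {p \<in> X. enat (dim (tangent_space X p)) \<noteq> variety_dim X}"

text \<open>The points where the plane curve \<open>X\<close> is tangent to the circle with center \<open>c\<close> and radius \<open>r\<close>,
  i.e. where the two curves meet but do not intersect transversally. As with intersection
  multiplicity at least two, this includes every singular point of \<open>X\<close> lying on the circle.\<close>

definition circle_tangency_points :: "(real^2) set \<Rightarrow> real^2 \<Rightarrow> real \<Rightarrow> (real^2) set" where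
  "circle_tangency_points X c r = {p \<in> X \<inter> sphere c r.
     p \<in> singular_points X \<or> tangent_space X p = {v. v \<bullet> (p - c) = 0}}"

definition voronoi_cell :: "'a::euclidean_space set \<Rightarrow> 'a \<Rightarrow> 'a set" where
  "voronoi_cell S x = {y. \<forall>x'\<in>S. dist y x \<le> dist y x'}"

definition inscribed_disc :: "'a::euclidean_space set \<Rightarrow> 'a set \<Rightarrow> bool" where
  "inscribed_disc S B \<longleftrightarrow> (\<exists>p r. r > 0 \<and> B = ball p r \<and> S \<inter> B = {})"

definition delaunay_cells :: "'a::euclidean_space set \<Rightarrow> 'a set set" where
  "delaunay_cells S = {convex hull (closure B \<inter> S) | B. inscribed_disc S B}"

definition maximal_delaunay_cell :: "'a::euclidean_space set \<Rightarrow> 'a set \<Rightarrow> bool" where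
  "maximal_delaunay_cell S D \<longleftrightarrow>
     D \<in> delaunay_cells S \<and> \<not> (\<exists>D'\<in>delaunay_cells S. D \<subset> D')"

text \<open>Both notions of convergence require nonempty sets explicitly, because in the library
  \<open>infdist x {} = 0\<close>.\<close>

definition wijsman_convergent :: "(nat \<Rightarrow> 'a::euclidean_space set) \<Rightarrow> 'a set \<Rightarrow> bool" where
  "wijsman_convergent K L \<longleftrightarrow>
     (\<forall>n. closed (K n) \<and> K n \<noteq> {}) \<and> closed L \<and> L \<noteq> {} \<and>
     (\<forall>x. (\<lambda>n. infdist x (K n)) \<longlonglongrightarrow> infdist x L)"

definition hausdorff_distance :: "'a::euclidean_space set \<Rightarrow> 'a set \<Rightarrow> real" where
  "hausdorff_distance K L = max (SUP x\<in>K. infdist x L) (SUP y\<in>L. infdist y K)"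

definition hausdorff_convergent :: "(nat \<Rightarrow> 'a::euclidean_space set) \<Rightarrow> 'a set \<Rightarrow> bool" where
  "hausdorff_convergent K L \<longleftrightarrow>
     (\<forall>n. compact (K n) \<and> K n \<noteq> {}) \<and> compact L \<and> L \<noteq> {} \<and>
     (\<lambda>n. hausdorff_distance L (K n)) \<longlonglongrightarrow> 0"

end

theory Submission
  imports Defs "HOL-Computational_Algebra.Polynomial_Factorial" "HOL-Computational_Algebra.Field_as_Ring"
begin

text \<open>At a nonsingular point \<open>p\<close> the curve \<open>X\<close> coincides locally with the zero set of a polynomial \<open>F\<close> whose
  gradient at \<open>p\<close> is nonzero. Otherwise the irreducible factor \<open>f\<close> of \<open>F = f u\<close> through \<open>p\<close> meets \<open>X\<close> in a
  finite set, and multiplying \<open>u\<close> by polynomials that vanish on this set yields an element of the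
  vanishing ideal with nonzero derivative along the tangent space.

  For the Voronoi cells, a point of the cell of \<open>p\<close> satisfies the second-order condition for a nearest
  point. Strictly between \<open>p\<close> and this point the condition is strict, hence it persists for points of
  \<open>X\<close> near \<open>p\<close>, so the cells of \<open>X\<close> are lower semicontinuous at \<open>p\<close>; and cells of \<open>X\<close> are contained in
  cells of the samples. At singular points one takes \<open>p\<close> itself.

  For the Delaunay cells, every contact point of an inscribed disc is a point of tangency, so the
  contact set is affinely independent. The center and the radius of a disc inscribed in the sample
  that touches it near each contact point come from a maximization of a perturbed distance function.\<close>

section \<open>Local structure of plane curves at nonsingular points\<close>

text \<open>Bivariate polynomials are encoded as polynomials in the second coordinate over
  polynomials in the first, a type with unique prime factorization.\<close>

definition peval :: "real poly poly \<Rightarrow> real^2 \<Rightarrow> real" where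
  "peval P x = poly (poly P [:x $ 2:]) (x $ 1)"

lemma peval_simps [simp]:
  "peval 0 x = 0" "peval 1 x = 1" "peval [:c:] x = poly c (x $ 1)"
  "peval (P + Q) x = peval P x + peval Q x" "peval (P * Q) x = peval P x * peval Q x"
  "peval (pCons c P) x = poly c (x $ 1) + x $ 2 * peval P x"
  by (simp_all add: peval_def)

lemma real_polynomial_function_poly:
  assumes "real_polynomial_function f"
  shows "real_polynomial_function (\<lambda>x. poly c (f x))"
  by (induction c) (use assms in auto)

lemma real_polynomial_function_vec_nth: "real_polynomial_function (\<lambda>x::real^'n. x $ i)"
  by (rule real_polynomial_function.intros(1)) (rule bounded_linear_vec_nth)

lemma real_polynomial_function_peval: "real_polynomial_function (peval P)"
proof (induction P)
  case 0
  then show ?case by (simp add: peval_def[abs_def] real_polynomial_function.intros(2))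
next
  case (pCons c P)
  have "peval (pCons c P) = (\<lambda>x. poly c (x $ 1) + x $ 2 * peval P x)"
    by (rule ext) simp
  then show ?case
    using pCons real_polynomial_function_poly[OF real_polynomial_function_vec_nth]
      real_polynomial_function_vec_nth
    by (auto intro!: real_polynomial_function.intros(3,4))
qed

lemma real_polynomial_function_imp_peval:
  assumes "real_polynomial_function (f :: real^2 \<Rightarrow> real)"
  obtains P where "f = peval P"
proof -
  have "\<exists>P. f = peval P" using assms
  proof induction
    case (linear f)
    then interpret bounded_linear f .
    have "f x = peval [:[:0, f (axis 1 1):], [:f (axis 2 1):]:] x" for x
    proof -
      have "x = (x $ 1) *\<^sub>R axis 1 1 + (x $ 2) *\<^sub>R axis 2 1"
        unfolding vec_eq_iff forall_2 by (simp add: axis_def)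
      then have "f x = f ((x $ 1) *\<^sub>R axis 1 1 + (x $ 2) *\<^sub>R axis 2 1)"
        by (rule arg_cong)
      then show ?thesis by (simp add: add scale)
    qed
    then show ?case by blast
  next
    case (const c)
    have "(\<lambda>x. c) = peval [:[:c:]:]" by (rule ext) simp
    then show ?case by blast
  next
    case (add f g)
    then obtain P Q where "f = peval P" "g = peval Q" by blast
    then have "(\<lambda>x. f x + g x) = peval (P + Q)" by (auto simp: fun_eq_iff)
    then show ?case by blast
  next
    case (mult f g)
    then obtain P Q where "f = peval P" "g = peval Q" by blast
    then have "(\<lambda>x. f x * g x) = peval (P * Q)" by (auto simp: fun_eq_iff)
    then show ?case by blast
  qed
  then show thesis using that by blast
qed

section \<open>Elimination and finiteness of common zeros\<close>

text \<open>A nonzero element \<open>h\<close> of least degree in the ideal of \<open>f\<close> and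
  \<open>g\<close> pseudo-divides both, that is, it divides them after multiplication by nonzero
  constants \<open>c\<close> and \<open>d\<close>. Primality of \<open>f\<close> then forces
  \<open>h\<close> itself to be constant.\<close>

lemma prime_elem_eliminate:
  fixes f g :: "'a::idom_divide poly"
  assumes f: "prime_elem f" and fg: "\<not> f dvd g"
  obtains a b r where "r \<noteq> 0" "a * f + b * g = [:r:]"
proof -
  define I where "I = {a * f + b * g | a b. True}"
  have fI: "f \<in> I"
    unfolding I_def by (rule CollectI, rule exI[of _ 1], rule exI[of _ 0]) simp
  have gI: "g \<in> I"
    unfolding I_def by (rule CollectI, rule exI[of _ 0], rule exI[of _ 1]) simp
  have f0: "f \<noteq> 0" using f by auto
  obtain h where h: "h \<in> I" "h \<noteq> 0" and hmin: "\<And>k. k \<in> I \<Longrightarrow> k \<noteq> 0 \<Longrightarrow> degree h \<le> degree k"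
  proof -
    have "\<exists>h. (h \<in> I \<and> h \<noteq> 0) \<and> (\<forall>k. k \<in> I \<and> k \<noteq> 0 \<longrightarrow> degree h \<le> degree k)"
      using ex_has_least_nat[of "\<lambda>h. h \<in> I \<and> h \<noteq> 0" f degree] fI f0 by blast
    then show ?thesis using that by blast
  qed
  have red: "\<exists>c q. c \<noteq> 0 \<and> [:c:] * k = h * q" if k: "k \<in> I" for k
  proof -
    obtain c q where cq: "c \<noteq> 0" "smult c k = h * q + pseudo_mod k h"
      using pseudo_mod(1)[OF h(2), of k] by blast
    have "pseudo_mod k h \<in> I"
    proof -
      obtain a b where k': "k = a * f + b * g" using k I_def by auto
      obtain a' b' where h': "h = a' * f + b' * g" using h I_def by auto
      have "pseudo_mod k h = [:c:] * k - q * h" using cq(2) by (simp add: algebra_simps)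
      also have "\<dots> = ([:c:] * a - q * a') * f + ([:c:] * b - q * b') * g"
        unfolding k' h' by (simp only: algebra_simps)
      finally show ?thesis unfolding I_def by blast
    qed
    then have "pseudo_mod k h = 0"
      using hmin[of "pseudo_mod k h"] pseudo_mod(2)[OF h(2), of k] by fastforce
    then show ?thesis using cq by auto
  qed
  obtain c q where c: "c \<noteq> 0" "[:c:] * f = h * q" using red[OF fI] by blast
  obtain d q' where d: "d \<noteq> 0" "[:d:] * g = h * q'" using red[OF gI] by blast
  \<comment> \<open>If \<open>f\<close> divides \<open>h\<close>, it divides
    \<open>[:d:] * g\<close> and hence the constant \<open>[:d:]\<close>, so \<open>f\<close> is
    constant and \<open>h\<close> is too by minimality. If \<open>f\<close> divides
    \<open>q\<close>, cancelling \<open>f\<close> makes \<open>h\<close> a divisor of the constant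
    \<open>[:c:]\<close>.\<close>
  have "f dvd h * q" using c(2) by (metis dvd_triv_right)
  then consider "f dvd h" | "f dvd q" using f prime_elem_dvd_mult_iff by blast
  then have "degree h = 0"
  proof cases
    case 1
    then have "f dvd [:d:] * g" using d(2) by (simp add: dvd_mult2)
    then have "f dvd [:d:]" using f fg prime_elem_dvd_mult_iff by blast
    then have "degree f = 0" using d(1)
      by (metis degree_pCons_0 dvd_imp_degree_le le_zero_eq pCons_eq_0_iff)
    then show ?thesis using hmin[OF fI f0] by simp
  next
    case 2
    then obtain b where "q = f * b" by blast
    then have "[:c:] = h * b" using c(2) f0
      by (metis mult.commute mult.left_commute mult_left_cancel)
    then show ?thesis using c(1)
      by (metis degree_pCons_0 dvd_imp_degree_le dvd_triv_left le_zero_eq pCons_eq_0_iff)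
  qed
  then obtain r where "h = [:r:]" by (meson degree_eq_zeroE)
  with h obtain a b where "r \<noteq> 0" "a * f + b * g = [:r:]"
    unfolding I_def by auto
  then show thesis by (rule that)
qed

text \<open>Every coefficient has the root \<open>a\<close> and so the linear factor. This treats
  polynomials that vanish identically on a vertical line.\<close>

lemma root_const_dvd:
  fixes P :: "'a::idom poly poly"
  assumes "map_poly (\<lambda>c. poly c a) P = 0"
  shows "[:[:- a, 1:]:] dvd P"
proof -
  have "\<forall>n. [:- a, 1:] dvd coeff P n"
  proof
    fix n
    have "coeff (map_poly (\<lambda>c. poly c a) P) n = 0" using assms by simp
    then show "[:- a, 1:] dvd coeff P n" by (simp add: coeff_map_poly poly_eq_0_iff_dvd)
  qed
  then show ?thesis by (simp add: const_poly_dvd_iff)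
qed

lemma peval_map_poly: "peval P x = poly (map_poly (\<lambda>c. poly c (x $ 1)) P) (x $ 2)"
  by (induction P) (simp_all add: map_poly_pCons)

text \<open>The eliminant \<open>r\<close> leaves finitely many first coordinates. On each of these
  vertical lines one of the two polynomials is not identically zero: otherwise the linear factor of
  the line divides both, and the irreducible \<open>f\<close>, being associated to it, divides
  \<open>g\<close>.\<close>

lemma finite_common_zeros:
  assumes f: "prime_elem f" and fg: "\<not> f dvd g"
  shows "finite {x. peval f x = 0 \<and> peval g x = 0}"
proof -
  let ?Z = "{x. peval f x = 0 \<and> peval g x = 0}"
  obtain a b r where r: "r \<noteq> 0" "a * f + b * g = [:r:]"
    by (rule prime_elem_eliminate[OF f fg])
  have root: "poly r (x $ 1) = 0" if "x \<in> ?Z" for x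
  proof -
    have "peval [:r:] x = 0" unfolding r(2)[symmetric] using that by simp
    then show ?thesis by simp
  qed
  let ?ev = "\<lambda>s P. map_poly (\<lambda>c. poly c s) P"
  let ?Y = "\<lambda>s. {t. poly (?ev s f) t = 0 \<and> poly (?ev s g) t = 0}"
  have finY: "finite (?Y s)" for s
  proof -
    have "?ev s f \<noteq> 0 \<or> ?ev s g \<noteq> 0"
    proof (rule ccontr)
      assume "\<not> ?thesis"
      then have l: "[:[:- s, 1:]:] dvd f" "[:[:- s, 1:]:] dvd g"
        using root_const_dvd by blast+
      then obtain k where k: "f = [:[:- s, 1:]:] * k" by blast
      have nu: "\<not> is_unit [:[:- s, 1:]:]"
        by (auto simp: is_unit_const_poly_iff is_unit_poly_iff)
      have "is_unit k" using prime_elem_imp_irreducible[OF f] k nu irreducibleD by blast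
      then have "f dvd [:[:- s, 1:]:]" using k by (metis dvd_refl mult_unit_dvd_iff)
      then show False using l(2) fg dvd_trans by blast
    qed
    then show ?thesis
    proof
      assume "?ev s f \<noteq> 0"
      then show ?thesis by (rule finite_subset[OF _ poly_roots_finite, rotated]) auto
    next
      assume "?ev s g \<noteq> 0"
      then show ?thesis by (rule finite_subset[OF _ poly_roots_finite, rotated]) auto
    qed
  qed
  have "?Z \<subseteq> (\<Union>s\<in>{s. poly r s = 0}. (\<lambda>t. vector [s, t]) ` ?Y s)"
  proof
    fix x assume x: "x \<in> ?Z"
    have "x = vector [x $ 1, x $ 2]" unfolding vec_eq_iff forall_2 by simp
    then show "x \<in> (\<Union>s\<in>{s. poly r s = 0}. (\<lambda>t. vector [s, t]) ` ?Y s)"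
      using root[OF x] x by (auto simp: peval_map_poly)
  qed
  moreover have "finite (\<Union>s\<in>{s. poly r s = 0}. (\<lambda>t. vector [s, t] :: real^2) ` ?Y s)"
    using poly_roots_finite[OF r(1)] finY by blast
  ultimately show ?thesis using finite_subset by blast
qed

lemma prime_factor_at_zero:
  assumes "F \<noteq> 0" "peval F p = 0"
  obtains f u where "prime_elem f" "F = f * u" "peval f p = 0"
proof -
  have "\<exists>f u. prime_elem f \<and> F = f * u \<and> peval f p = 0" using assms
  proof (induction F rule: prime_divisors_induct)
    case zero
    then show ?case by simp
  next
    case (unit F)
    then obtain G where "1 = F * G" by blast
    then have "1 = peval F p * peval G p" by (metis peval_simps(2,5))
    then show ?case using unit by simp
  next
    case (factor f F)
    show ?case
    proof (cases "peval f p = 0")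
      case True
      then show ?thesis using factor(1) by blast
    next
      case False
      then have "F \<noteq> 0" "peval F p = 0" using factor by auto
      then obtain f' u where "prime_elem f'" "F = f' * u" "peval f' p = 0"
        using factor by blast
      then have "prime_elem f' \<and> f * F = f' * (f * u) \<and> peval f' p = 0"
        by (simp add: mult.left_commute)
      then show ?thesis by blast
    qed
  qed
  then show thesis using that by blast
qed

section \<open>Tangent spaces and local equations\<close>

lemma real_polynomial_function_has_derivative:
  fixes f :: "'a::euclidean_space \<Rightarrow> real"
  assumes "real_polynomial_function f"
  shows "(f has_derivative frechet_derivative f (at p)) (at p)"
  using assms differentiable_at_polynomial_function frechet_derivative_works
    real_polynomial_function_eq by blast

lemma subspace_tangent_space:
  fixes X :: "'a::euclidean_space set"
  shows "subspace (tangent_space X p)"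
proof -
  have "linear (frechet_derivative f (at p))" if "f \<in> vanishing_ideal X" for f
    using that real_polynomial_function_has_derivative has_derivative_linear
    unfolding vanishing_ideal_def by blast
  then show ?thesis
    unfolding subspace_def tangent_space_def
    by (auto simp: linear_0 linear_add linear_scale)
qed

lemma nonsingular_curve_locally_zero_set:
  fixes X :: "(real^2) set"
  assumes X: "algebraic_set X" and p: "p \<in> X" and dimT: "dim (tangent_space X p) = 1"
  obtains F U where "real_polynomial_function F" "open U" "p \<in> U" "X \<inter> U = {x \<in> U. F x = 0}"
    "tangent_space X p = {v. frechet_derivative F (at p) v = 0}"
    "frechet_derivative F (at p) \<noteq> (\<lambda>_. 0)"
proof -
  obtain G where G: "\<And>g. g \<in> G \<Longrightarrow> real_polynomial_function g" "X = {x. \<forall>g\<in>G. g x = 0}"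
    using X unfolding algebraic_set_def by blast
  let ?V = "vanishing_ideal X"
  let ?T = "tangent_space X p"
  have "?T \<noteq> UNIV" using dimT by auto
  then obtain F w where F: "F \<in> ?V" and w: "frechet_derivative F (at p) w \<noteq> 0"
    unfolding tangent_space_def by blast
  have Fpoly: "real_polynomial_function F" and FX: "\<And>x. x \<in> X \<Longrightarrow> F x = 0"
    using F unfolding vanishing_ideal_def by auto
  note DF = real_polynomial_function_has_derivative[OF Fpoly, of p]
  obtain P where P: "F = peval P" using real_polynomial_function_imp_peval[OF Fpoly] .
  have "P \<noteq> 0"
  proof
    assume "P = 0"
    then have "F = (\<lambda>x. 0)" using P by auto
    then show False using w by simp
  qed
  moreover have "peval P p = 0" using FX[OF p] P by simp
  ultimately obtain f u where f: "prime_elem f" "P = f * u" "peval f p = 0"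
    by (rule prime_factor_at_zero)
  have Ffu: "F x = peval f x * peval u x" for x using P f by simp
  \<comment> \<open>If both factors vanished at \<open>p\<close>, the product rule would make the
    derivative of \<open>F\<close> zero there.\<close>
  have up: "peval u p \<noteq> 0"
  proof
    assume u0: "peval u p = 0"
    have "(F has_derivative (\<lambda>h. peval f p * frechet_derivative (peval u) (at p) h
        + frechet_derivative (peval f) (at p) h * peval u p)) (at p)"
      unfolding Ffu[abs_def]
      by (intro has_derivative_mult real_polynomial_function_has_derivative
          real_polynomial_function_peval)
    then have "frechet_derivative F (at p) w = 0"
      using f u0 has_derivative_unique[OF DF] by simp
    then show False using w by simp
  qed
  \<comment> \<open>A single zero of \<open>f\<close> outside \<open>X\<close> gives a
    \<open>g\<close> in \<open>G\<close> that \<open>f\<close> does not divide, so the zeros of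
    \<open>f\<close> on \<open>X\<close> lie in a finite set.\<close>
  have fX: "x \<in> X" if "peval f x = 0" for x
  proof (rule ccontr)
    assume "x \<notin> X"
    then obtain g where g: "g \<in> G" "g x \<noteq> 0" using G by blast
    obtain Q where Q: "g = peval Q" using real_polynomial_function_imp_peval[OF G(1)[OF g(1)]] .
    have "\<not> f dvd Q"
    proof
      assume "f dvd Q"
      then obtain k where "Q = f * k" by (rule dvdE)
      then have "g x = 0" using that Q by simp
      then show False using g by simp
    qed
    define Z where "Z = {x. peval f x = 0 \<and> peval Q x = 0}"
    have finZ: "finite Z" unfolding Z_def by (rule finite_common_zeros[OF f(1) \<open>\<not> f dvd Q\<close>])
    have "dim ?T \<noteq> 0" using dimT by linarith
    then obtain v where v: "v \<in> ?T" "v \<noteq> 0"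
      unfolding dim_eq_0 by blast
    \<comment> \<open>On \<open>X\<close>, the factor \<open>peval u\<close> vanishes off the zeros
      of \<open>f\<close>, the product vanishes on \<open>Z - {p}\<close>, and the linear factor of
      \<open>h\<close> vanishes at \<open>p\<close>. So \<open>h\<close> is in the vanishing ideal,
      yet its derivative at \<open>p\<close> along the tangent vector \<open>v\<close> is
      \<open>(v \<bullet> v) * k p\<close>, which is nonzero.\<close>
    define k where "k = (\<lambda>x. peval u x * (\<Prod>q\<in>Z - {p}. (x - q) \<bullet> (x - q)))"
    define h where "h = (\<lambda>x. ((x - p) \<bullet> v) * k x)"
    have lin: "real_polynomial_function (\<lambda>x. (x - q) \<bullet> w)" for q w :: "real^2"
    proof -
      have "real_polynomial_function (\<lambda>x. x \<bullet> w - q \<bullet> w)"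
        by (intro real_polynomial_function_diff real_polynomial_function.intros(1,2)
            bounded_linear_inner_left)
      then show ?thesis by (simp add: inner_diff_left)
    qed
    have "real_polynomial_function (\<lambda>x. (x - q) \<bullet> (x - q))" for q :: "real^2"
    proof -
      have "real_polynomial_function (\<lambda>x. \<Sum>b\<in>Basis. ((x - q) \<bullet> b) * ((x - q) \<bullet> b))"
        by (intro real_polynomial_function_sum real_polynomial_function.intros(4) lin) simp
      then show ?thesis by (simp add: euclidean_inner[symmetric])
    qed
    then have kpoly: "real_polynomial_function k"
      unfolding k_def using finZ
      by (intro real_polynomial_function.intros(4) real_polynomial_function_prod
          real_polynomial_function_peval) auto
    then have hpoly: "real_polynomial_function h"
      unfolding h_def by (intro real_polynomial_function.intros(4) lin)
    have "h x = 0" if x: "x \<in> X" for x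
    proof -
      have "peval Q x = 0" using x G g Q by blast
      then consider "peval u x = 0" | "x \<in> Z" using FX[OF x] Ffu[of x] by (auto simp: Z_def)
      then show ?thesis
        by cases (use finZ in \<open>auto simp: h_def k_def\<close>)
    qed
    then have "h \<in> ?V" using hpoly by (simp add: vanishing_ideal_def)
    then have "frechet_derivative h (at p) v = 0" using v by (simp add: tangent_space_def)
    moreover have "(h has_derivative (\<lambda>y. ((p - p) \<bullet> v) * frechet_derivative k (at p) y
        + (y \<bullet> v) * k p)) (at p)"
      unfolding h_def
      by (intro has_derivative_mult real_polynomial_function_has_derivative kpoly)
        (auto intro!: derivative_eq_intros)
    ultimately have "(v \<bullet> v) * k p = 0"
      using has_derivative_unique[OF real_polynomial_function_has_derivative[OF hpoly]] by auto
    then show False using v up finZ by (auto simp: k_def)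
  qed
  \<comment> \<open>Off the zeros of \<open>u\<close>, the zeros of \<open>F\<close> are those of
    \<open>f\<close>, and these lie in \<open>X\<close>.\<close>
  let ?U = "{x. peval u x \<noteq> 0}"
  have "open ?U"
    using real_polynomial_function_peval[of u] continuous_on_polymonial_function
    by (auto intro!: open_Collect_neq simp: real_polynomial_function_eq)
  moreover have "X \<inter> ?U = {x \<in> ?U. F x = 0}"
    using FX fX Ffu by auto
  moreover have "?T = {v. frechet_derivative F (at p) v = 0}"
  proof (rule subspace_dim_equal)
    have lin: "linear (frechet_derivative F (at p))"
      using DF has_derivative_linear by blast
    show sub: "subspace {v. frechet_derivative F (at p) v = 0}"
      by (rule linear_subspace_kernel[OF lin])
    show "?T \<subseteq> {v. frechet_derivative F (at p) v = 0}"
      using F unfolding tangent_space_def by blast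
    \<comment> \<open>A proper subspace of the plane has dimension at most 1, the dimension of the
      tangent space it contains.\<close>
    have "{v. frechet_derivative F (at p) v = 0} \<noteq> UNIV" using w by blast
    then have "dim {v. frechet_derivative F (at p) v = 0} \<noteq> 2"
      using sub dim_eq_full[of "{v. frechet_derivative F (at p) v = 0}"] by (simp add: span_eq_iff[THEN iffD2])
    moreover have "dim {v. frechet_derivative F (at p) v = 0} \<le> 2"
      using dim_subset_UNIV[of "{v. frechet_derivative F (at p) v = 0}"] by simp
    ultimately show "dim {v. frechet_derivative F (at p) v = 0} \<le> dim ?T"
      using dimT by simp
  qed (rule subspace_tangent_space)
  moreover have "frechet_derivative F (at p) \<noteq> (\<lambda>_. 0)" using w by auto
  ultimately show thesis using that[of F ?U] Fpoly up by blast
qed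

section \<open>Second-order expansion and tangent directions\<close>

lemma sgn_scaleR_norm: "norm v *\<^sub>R sgn v = (v::'a::real_normed_vector)"
  by (cases "v = 0") (simp_all add: sgn_div_norm)

text \<open>The second-order remainder depends only on the limiting direction of the secants, even when
  both endpoints move.\<close>

lemma polynomial_secant_expansion:
  fixes f :: "'a::euclidean_space \<Rightarrow> real"
  assumes "real_polynomial_function f"
  shows "\<exists>G H. continuous_on UNIV G \<and> (\<forall>x. (f has_derivative (\<lambda>v. G x \<bullet> v)) (at x)) \<and>
    (\<forall>x a p w. x \<longlonglongrightarrow> p \<longrightarrow> a \<longlonglongrightarrow> p \<longrightarrow> (\<forall>n. x n \<noteq> a n) \<longrightarrow> (\<lambda>n::nat. sgn (x n - a n)) \<longlonglongrightarrow> w \<longrightarrow>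
      (\<lambda>n. (f (x n) - f (a n) - G (a n) \<bullet> (x n - a n)) / (norm (x n - a n))\<^sup>2) \<longlonglongrightarrow> H p w)"
  using assms
proof induction
  case (linear f)
  then have lin: "linear f" by (rule bounded_linear.linear)
  have f: "adjoint f 1 \<bullet> v = f v" for v
    using adjoint_works[OF lin, of v 1] by (simp add: inner_commute)
  have "(f has_derivative (\<lambda>v. adjoint f 1 \<bullet> v)) (at x)" for x
    using bounded_linear_imp_has_derivative[OF linear] by (simp add: f)
  then show ?case
    by (intro exI[of _ "\<lambda>x. adjoint f 1"] exI[of _ "\<lambda>p w. 0"])
      (simp add: f linear_diff[OF lin])
next
  case (const c)
  show ?case
    by (intro exI[of _ "\<lambda>x. 0"] exI[of _ "\<lambda>p w. 0"]) simp
next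
  case (add f g)
  then obtain Gf Hf Gg Hg where
    Gf: "continuous_on UNIV Gf" "\<forall>x. (f has_derivative (\<lambda>v. Gf x \<bullet> v)) (at x)" and
    Hf: "\<forall>x a p w. x \<longlonglongrightarrow> p \<longrightarrow> a \<longlonglongrightarrow> p \<longrightarrow> (\<forall>n. x n \<noteq> a n) \<longrightarrow> (\<lambda>n::nat. sgn (x n - a n)) \<longlonglongrightarrow> w \<longrightarrow>
      (\<lambda>n. (f (x n) - f (a n) - Gf (a n) \<bullet> (x n - a n)) / (norm (x n - a n))\<^sup>2) \<longlonglongrightarrow> Hf p w" and
    Gg: "continuous_on UNIV Gg" "\<forall>x. (g has_derivative (\<lambda>v. Gg x \<bullet> v)) (at x)" and
    Hg: "\<forall>x a p w. x \<longlonglongrightarrow> p \<longrightarrow> a \<longlonglongrightarrow> p \<longrightarrow> (\<forall>n. x n \<noteq> a n) \<longrightarrow> (\<lambda>n::nat. sgn (x n - a n)) \<longlonglongrightarrow> w \<longrightarrow>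
      (\<lambda>n. (g (x n) - g (a n) - Gg (a n) \<bullet> (x n - a n)) / (norm (x n - a n))\<^sup>2) \<longlonglongrightarrow> Hg p w"
    by blast
  show ?case
  proof (intro exI[of _ "\<lambda>x. Gf x + Gg x"] exI[of _ "\<lambda>p w. Hf p w + Hg p w"] conjI allI impI)
    show "continuous_on UNIV (\<lambda>x. Gf x + Gg x)"
      by (intro continuous_on_add Gf Gg)
    show "((\<lambda>x. f x + g x) has_derivative (\<lambda>v. (Gf x + Gg x) \<bullet> v)) (at x)" for x
      using has_derivative_add[OF Gf(2)[rule_format, of x] Gg(2)[rule_format, of x]]
      by (simp add: inner_add_left)
    fix x a :: "nat \<Rightarrow> 'a" and p w
    assume *: "x \<longlonglongrightarrow> p" "a \<longlonglongrightarrow> p" "\<forall>n. x n \<noteq> a n" "(\<lambda>n::nat. sgn (x n - a n)) \<longlonglongrightarrow> w"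
    have "(\<lambda>n. (f (x n) - f (a n) - Gf (a n) \<bullet> (x n - a n)) / (norm (x n - a n))\<^sup>2 +
       (g (x n) - g (a n) - Gg (a n) \<bullet> (x n - a n)) / (norm (x n - a n))\<^sup>2) \<longlonglongrightarrow> Hf p w + Hg p w"
      using tendsto_add[OF Hf[rule_format, OF *(1,2) _ *(4)] Hg[rule_format, OF *(1,2) _ *(4)]] *(3) by blast
    moreover have "(f (x n) - f (a n) - Gf (a n) \<bullet> (x n - a n)) / (norm (x n - a n))\<^sup>2 +
       (g (x n) - g (a n) - Gg (a n) \<bullet> (x n - a n)) / (norm (x n - a n))\<^sup>2 =
       (f (x n) + g (x n) - (f (a n) + g (a n)) - (Gf (a n) + Gg (a n)) \<bullet> (x n - a n)) / (norm (x n - a n))\<^sup>2" for n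
      by (simp add: inner_add_left add_divide_distrib[symmetric])
    ultimately show "(\<lambda>n. (f (x n) + g (x n) - (f (a n) + g (a n)) - (Gf (a n) + Gg (a n)) \<bullet> (x n - a n))
        / (norm (x n - a n))\<^sup>2) \<longlonglongrightarrow> Hf p w + Hg p w"
      by simp
  qed
next
  case (mult f g)
  then obtain Gf Hf Gg Hg where
    Gf: "continuous_on UNIV Gf" "\<forall>x. (f has_derivative (\<lambda>v. Gf x \<bullet> v)) (at x)" and
    Hf: "\<forall>x a p w. x \<longlonglongrightarrow> p \<longrightarrow> a \<longlonglongrightarrow> p \<longrightarrow> (\<forall>n. x n \<noteq> a n) \<longrightarrow> (\<lambda>n::nat. sgn (x n - a n)) \<longlonglongrightarrow> w \<longrightarrow>
      (\<lambda>n. (f (x n) - f (a n) - Gf (a n) \<bullet> (x n - a n)) / (norm (x n - a n))\<^sup>2) \<longlonglongrightarrow> Hf p w" and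
    Gg: "continuous_on UNIV Gg" "\<forall>x. (g has_derivative (\<lambda>v. Gg x \<bullet> v)) (at x)" and
    Hg: "\<forall>x a p w. x \<longlonglongrightarrow> p \<longrightarrow> a \<longlonglongrightarrow> p \<longrightarrow> (\<forall>n. x n \<noteq> a n) \<longrightarrow> (\<lambda>n::nat. sgn (x n - a n)) \<longlonglongrightarrow> w \<longrightarrow>
      (\<lambda>n. (g (x n) - g (a n) - Gg (a n) \<bullet> (x n - a n)) / (norm (x n - a n))\<^sup>2) \<longlonglongrightarrow> Hg p w"
    by blast
  have cf: "continuous_on UNIV f" and cg: "continuous_on UNIV g"
    using Gf(2) Gg(2) by (meson has_derivative_continuous continuous_at_imp_continuous_on)+
  \<comment> \<open>For a unit vector \<open>w\<close>, \<open>H p w\<close> is half the second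
    derivative in direction \<open>w\<close>; this is its product rule.\<close>
  let ?H = "\<lambda>p w. f p * Hg p w + g p * Hf p w + (Gf p \<bullet> w) * (Gg p \<bullet> w)"
  show ?case
  proof (intro exI[of _ "\<lambda>x. f x *\<^sub>R Gg x + g x *\<^sub>R Gf x"] exI[of _ ?H] conjI allI impI)
    show "continuous_on UNIV (\<lambda>x. f x *\<^sub>R Gg x + g x *\<^sub>R Gf x)"
      by (intro continuous_on_add continuous_on_scaleR Gf Gg cf cg)
    show "((\<lambda>x. f x * g x) has_derivative (\<lambda>v. (f x *\<^sub>R Gg x + g x *\<^sub>R Gf x) \<bullet> v)) (at x)" for x
      using has_derivative_mult[OF Gf(2)[rule_format, of x] Gg(2)[rule_format, of x]]
      by (simp add: inner_add_left mult.commute)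
    fix x a :: "nat \<Rightarrow> 'a" and p w
    assume *: "x \<longlonglongrightarrow> p" "a \<longlonglongrightarrow> p" "\<forall>n. x n \<noteq> a n" "(\<lambda>n::nat. sgn (x n - a n)) \<longlonglongrightarrow> w"
    define N where "N = (\<lambda>n. norm (x n - a n))"
    have N: "N n \<noteq> 0" for n using *(3) by (simp add: N_def)
    have "(\<lambda>n. norm (x n - a n)) \<longlonglongrightarrow> norm (p - p)"
      by (intro tendsto_intros *)
    then have N0: "N \<longlonglongrightarrow> 0" by (simp add: N_def)
    have v: "x n - a n = N n *\<^sub>R sgn (x n - a n)" for n
      by (simp add: N_def sgn_scaleR_norm)
    define Rf where "Rf = (\<lambda>n. (f (x n) - f (a n) - Gf (a n) \<bullet> (x n - a n)) / (N n)\<^sup>2)"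
    define Rg where "Rg = (\<lambda>n. (g (x n) - g (a n) - Gg (a n) \<bullet> (x n - a n)) / (N n)\<^sup>2)"
    have Rf: "Rf \<longlonglongrightarrow> Hf p w" and Rg: "Rg \<longlonglongrightarrow> Hg p w"
      using Hf[rule_format, OF *(1,2) _ *(4)] Hg[rule_format, OF *(1,2) _ *(4)] *(3)
      unfolding Rf_def Rg_def N_def by blast+
    \<comment> \<open>The difference quotient of \<open>f\<close> is \<open>Rf n * N n\<close> plus
      the gradient term, and likewise for \<open>g\<close>; the remainders disappear in the limit
      because \<open>N\<close> tends to 0.\<close>
    have lim: "(\<lambda>n. f (a n) * Rg n + g (a n) * Rf n +
        (Rf n * N n + Gf (a n) \<bullet> sgn (x n - a n)) * (Rg n * N n + Gg (a n) \<bullet> sgn (x n - a n))) \<longlonglongrightarrow>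
        f p * Hg p w + g p * Hf p w + (Hf p w * 0 + Gf p \<bullet> w) * (Hg p w * 0 + Gg p \<bullet> w)"
      by (intro tendsto_intros Rf Rg N0 *(4) continuous_on_tendsto_compose[OF cf *(2)] continuous_on_tendsto_compose[OF cg *(2)]
          continuous_on_tendsto_compose[OF Gf(1) *(2)] continuous_on_tendsto_compose[OF Gg(1) *(2)]) auto
    have eq: "f (a n) * Rg n + g (a n) * Rf n +
        (Rf n * N n + Gf (a n) \<bullet> sgn (x n - a n)) * (Rg n * N n + Gg (a n) \<bullet> sgn (x n - a n)) =
        (f (x n) * g (x n) - f (a n) * g (a n) - (f (a n) *\<^sub>R Gg (a n) + g (a n) *\<^sub>R Gf (a n)) \<bullet> (x n - a n)) / (N n)\<^sup>2" for n
    proof -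
      define s where "s = sgn (x n - a n)"
      have vs: "x n - a n = N n *\<^sub>R s" using v[of n] by (simp only: s_def)
      have in1: "Gf (a n) \<bullet> (x n - a n) = N n * (Gf (a n) \<bullet> s)"
        "Gg (a n) \<bullet> (x n - a n) = N n * (Gg (a n) \<bullet> s)"
        by (simp_all add: vs)
      have "Rf n * (N n)\<^sup>2 = f (x n) - f (a n) - Gf (a n) \<bullet> (x n - a n)"
        "Rg n * (N n)\<^sup>2 = g (x n) - g (a n) - Gg (a n) \<bullet> (x n - a n)"
        using N[of n] by (simp_all add: Rf_def Rg_def)
      then have fx: "f (x n) = f (a n) + N n * (Gf (a n) \<bullet> s) + Rf n * (N n)\<^sup>2"
        and gx: "g (x n) = g (a n) + N n * (Gg (a n) \<bullet> s) + Rg n * (N n)\<^sup>2"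
        unfolding in1 by linarith+
      show ?thesis
        unfolding s_def[symmetric] inner_add_left inner_scaleR_left in1 fx gx
        using N[of n] by (simp add: field_simps power2_eq_square)
    qed
    then show "(\<lambda>n. (f (x n) * g (x n) - f (a n) * g (a n) - (f (a n) *\<^sub>R Gg (a n) + g (a n) *\<^sub>R Gf (a n)) \<bullet> (x n - a n))
        / (norm (x n - a n))\<^sup>2) \<longlonglongrightarrow> ?H p w"
      using lim unfolding eq N_def by simp
  qed
qed

text \<open>This takes the place of the implicit function theorem. After a short step
  \<open>s\<close>, the values of \<open>f\<close> at
  \<open>p + s *\<^sub>R (w + t *\<^sub>R g)\<close> for \<open>t = e\<close> and
  \<open>t = - e\<close> have opposite signs, so the intermediate value theorem gives a zero whose
  direction differs from \<open>w\<close> by at most \<open>e *\<^sub>R g\<close>.\<close>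

lemma zero_set_tangent_sequence:
  fixes f :: "'a::euclidean_space \<Rightarrow> real"
  assumes cont: "continuous_on UNIV f" and der: "(f has_derivative (\<lambda>v. g \<bullet> v)) (at p)"
    and fp: "f p = 0" and g: "g \<noteq> 0" and w: "norm w = 1" "g \<bullet> w = 0"
  obtains x :: "nat \<Rightarrow> 'a" where "x \<longlonglongrightarrow> p" "\<And>n. x n \<noteq> p" "\<And>n. f (x n) = 0" "(\<lambda>n. sgn (x n - p)) \<longlonglongrightarrow> w"
proof -
  have dir: "((\<lambda>s. f (p + s *\<^sub>R v)) has_real_derivative g \<bullet> v) (at 0)" for v
  proof -
    have "((\<lambda>s. p + s *\<^sub>R v) has_derivative (\<lambda>s. s *\<^sub>R v)) (at 0)"
      by (auto intro!: derivative_eq_intros)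
    then have "((\<lambda>s. f (p + s *\<^sub>R v)) has_derivative (\<lambda>s. g \<bullet> (s *\<^sub>R v))) (at 0)"
      by (rule has_derivative_compose) (use der in simp)
    then show ?thesis
      by (simp add: has_field_derivative_def mult.commute[of _ "g \<bullet> v"])
  qed
  have step: "\<exists>s t. 0 < s \<and> s < e \<and> \<bar>t\<bar> \<le> e \<and> f (p + s *\<^sub>R (w + t *\<^sub>R g)) = 0" if e: "e > 0" for e :: real
  proof -
    have gg: "g \<bullet> g > 0" using g by simp
    have "g \<bullet> (w + e *\<^sub>R g) > 0" using e gg w by (simp add: inner_add_right)
    from DERIV_pos_inc_right[OF dir this] obtain d where
      d: "d > 0" "\<And>h. 0 < h \<Longrightarrow> h < d \<Longrightarrow> f p < f (p + h *\<^sub>R (w + e *\<^sub>R g))" by auto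
    have "g \<bullet> (w + (-e) *\<^sub>R g) < 0" using e gg w by (simp add: inner_diff_right)
    from DERIV_neg_dec_right[OF dir this] obtain d' where
      d': "d' > 0" "\<And>h. 0 < h \<Longrightarrow> h < d' \<Longrightarrow> f (p + h *\<^sub>R (w + (-e) *\<^sub>R g)) < f p" by auto
    obtain s where s: "0 < s" "s < e" "s < d" "s < d'"
      using field_lbound_gt_zero[of e "min d d'"] e d(1) d'(1) by auto
    have "continuous_on {-e..e} (\<lambda>t. f (p + s *\<^sub>R (w + t *\<^sub>R g)))"
      by (intro continuous_on_compose2[OF cont] continuous_intros) auto
    then have "\<exists>t\<ge>-e. t \<le> e \<and> f (p + s *\<^sub>R (w + t *\<^sub>R g)) = 0"
      using d(2)[of s] d'(2)[of s] s e fp by (intro IVT') auto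
    then show ?thesis using s by (metis abs_le_iff minus_le_iff)
  qed
  have "\<forall>n. \<exists>s t. 0 < s \<and> s < inverse (real (Suc n)) \<and> \<bar>t\<bar> \<le> inverse (real (Suc n)) \<and>
      f (p + s *\<^sub>R (w + t *\<^sub>R g)) = 0"
    by (intro allI step) simp
  then obtain s t where st: "\<And>n::nat. 0 < s n" "\<And>n. s n < inverse (real (Suc n))"
    "\<And>n. \<bar>t n\<bar> \<le> inverse (real (Suc n))" "\<And>n. f (p + s n *\<^sub>R (w + t n *\<^sub>R g)) = 0" by metis
  have s0: "s \<longlonglongrightarrow> 0"
    by (rule Lim_null_comparison[OF _ LIMSEQ_inverse_real_of_nat])
      (use st(1,2) in \<open>simp add: less_imp_le\<close>)
  have t0: "t \<longlonglongrightarrow> 0"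
    by (rule Lim_null_comparison[OF _ LIMSEQ_inverse_real_of_nat])
      (use st(3) in simp)
  have nz: "w + t n *\<^sub>R g \<noteq> 0" for n
  proof
    assume "w + t n *\<^sub>R g = 0"
    then have "(w + t n *\<^sub>R g) \<bullet> w = 0" by simp
    then show False using w by (simp add: inner_add_left dot_square_norm)
  qed
  define x where "x = (\<lambda>n. p + s n *\<^sub>R (w + t n *\<^sub>R g))"
  have "x \<longlonglongrightarrow> p + 0 *\<^sub>R (w + 0 *\<^sub>R g)"
    unfolding x_def by (intro tendsto_intros s0 t0)
  moreover have "x n \<noteq> p" for n
    using nz[of n] st(1)[of n] by (simp add: x_def)
  moreover have "(\<lambda>n. sgn (x n - p)) \<longlonglongrightarrow> w"
  proof -
    have "(\<lambda>n. sgn (w + t n *\<^sub>R g)) \<longlonglongrightarrow> sgn (w + 0 *\<^sub>R g)"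
      using w(1) by (intro tendsto_intros t0) auto
    moreover have "sgn (x n - p) = sgn (w + t n *\<^sub>R g)" for n
      using st(1)[of n] by (simp add: x_def sgn_scaleR)
    ultimately show ?thesis using w(1) by (simp add: sgn_div_norm)
  qed
  ultimately show thesis using st(4) by (intro that[of x]) (auto simp: x_def)
qed

section \<open>Voronoi cells as intersections of half-spaces\<close>

text \<open>Squaring and cancelling makes the condition linear in \<open>y\<close>, which fits
  expansions around \<open>p\<close>.\<close>

lemma voronoi_cell_iff:
  "y \<in> voronoi_cell S p \<longleftrightarrow> (\<forall>x\<in>S. 2 * ((x - p) \<bullet> (y - p)) \<le> (norm (x - p))\<^sup>2)"
proof -
  have "dist y p \<le> dist y x \<longleftrightarrow> 2 * ((x - p) \<bullet> (y - p)) \<le> (norm (x - p))\<^sup>2" for x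
  proof -
    have "dist y p \<le> dist y x \<longleftrightarrow> (dist y p)\<^sup>2 \<le> (dist y x)\<^sup>2"
      by (simp add: abs_le_square_iff[symmetric])
    also have "(dist y x)\<^sup>2 = (dist y p)\<^sup>2 - 2 * ((x - p) \<bullet> (y - p)) + (norm (x - p))\<^sup>2"
    proof -
      have "y - x = (y - p) - (x - p)" by simp
      then show ?thesis
        by (simp only: dist_norm power2_norm_eq_inner) (simp add: inner_diff_left inner_diff_right inner_commute)
    qed
    finally show ?thesis by auto
  qed
  then show ?thesis by (simp add: voronoi_cell_def)
qed

lemma closed_voronoi_cell: "closed (voronoi_cell S p)"
proof -
  have "voronoi_cell S p = (\<Inter>x\<in>S. {y. dist y p \<le> dist y x})"
    by (auto simp: voronoi_cell_def)
  then show ?thesis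
    by (auto intro!: closed_INT closed_Collect_le continuous_intros)
qed

section \<open>Convergence of Voronoi cells\<close>

lemma not_eventually_sequentially_subseq:
  assumes "\<not> (\<forall>\<^sub>F n in sequentially. P n)"
  shows "\<exists>r :: nat \<Rightarrow> nat. strict_mono r \<and> (\<forall>n. \<not> P (r n))"
proof -
  have "\<exists>\<^sub>F n in cofinite. \<not> P n"
    using assms by (simp only: cofinite_eq_sequentially frequently_def not_not simp_thms)
  then have "infinite {n. \<not> P n}" unfolding frequently_cofinite .
  from infinite_enumerate[OF this] show ?thesis by auto
qed

lemma eventually_in_zero_set:
  assumes "open U" "p \<in> U" "X \<inter> U = {x \<in> U. f x = 0}" "x \<longlonglongrightarrow> p" "\<And>n. f (x n) = 0"
  shows "\<forall>\<^sub>F n in sequentially. x n \<in> X"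
  using topological_tendstoD[OF assms(4,1,2)] by eventually_elim (use assms(3,5) in auto)

text \<open>First-order condition for a nearest point. The component \<open>d\<close> of
  \<open>y - p\<close> orthogonal to \<open>g\<close> is a tangent direction; if nonzero, it is
  approached by secants of \<open>X\<close>, and dividing the cell inequality by the secant length
  gives \<open>sgn d \<bullet> d \<le> 0\<close> in the limit.\<close>

lemma voronoi_cell_subset_normal:
  fixes f :: "'a::euclidean_space \<Rightarrow> real"
  assumes cont: "continuous_on UNIV f" and der: "(f has_derivative (\<lambda>v. g \<bullet> v)) (at p)"
    and g: "g \<noteq> 0" and p: "p \<in> X" and U: "open U" "p \<in> U" "X \<inter> U = {x \<in> U. f x = 0}"
    and y: "y \<in> voronoi_cell X p"
  obtains l where "y - p = l *\<^sub>R g"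
proof -
  define l where "l = ((y - p) \<bullet> g) / (g \<bullet> g)"
  define d where "d = (y - p) - l *\<^sub>R g"
  have dg: "g \<bullet> d = 0"
    using g by (simp add: d_def l_def inner_diff_right inner_commute)
  have "d = 0"
  proof (rule ccontr)
    assume d0: "d \<noteq> 0"
    have "f p = 0" using p U by blast
    moreover have "norm (sgn d) = 1" "g \<bullet> sgn d = 0"
      using d0 dg by (simp_all add: norm_sgn sgn_div_norm)
    ultimately obtain x :: "nat \<Rightarrow> 'a" where x: "x \<longlonglongrightarrow> p" "\<And>n. x n \<noteq> p" "\<And>n. f (x n) = 0" "(\<lambda>n. sgn (x n - p)) \<longlonglongrightarrow> sgn d"
      using zero_set_tangent_sequence[OF cont der _ g, of "sgn d"] by metis
    have "\<forall>\<^sub>F n in sequentially. 2 * (sgn (x n - p) \<bullet> (y - p)) \<le> norm (x n - p)"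
      using eventually_in_zero_set[OF U x(1,3)]
    proof eventually_elim
      case (elim n)
      then have "2 * ((x n - p) \<bullet> (y - p)) \<le> (norm (x n - p))\<^sup>2"
        using y voronoi_cell_iff by blast
      then have "2 * ((norm (x n - p) *\<^sub>R sgn (x n - p)) \<bullet> (y - p)) \<le> (norm (x n - p))\<^sup>2"
        by (simp only: sgn_scaleR_norm)
      then have "norm (x n - p) * (2 * (sgn (x n - p) \<bullet> (y - p))) \<le> norm (x n - p) * norm (x n - p)"
        by (simp add: power2_eq_square)
      then show ?case using x(2)[of n] by (simp add: mult_le_cancel_left)
    qed
    moreover have "(\<lambda>n. 2 * (sgn (x n - p) \<bullet> (y - p))) \<longlonglongrightarrow> 2 * (sgn d \<bullet> (y - p))"
      by (intro tendsto_intros x(4))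
    moreover have "(\<lambda>n. norm (x n - p)) \<longlonglongrightarrow> norm (p - p)"
      by (intro tendsto_intros x(1))
    ultimately have "2 * (sgn d \<bullet> (y - p)) \<le> 0"
      using tendsto_le[of sequentially "\<lambda>n. norm (x n - p)"] by fastforce
    moreover have "sgn d \<bullet> (y - p) = sgn d \<bullet> d"
    proof -
      have "y - p = d + l *\<^sub>R g" by (simp add: d_def)
      then show ?thesis using dg by (simp add: inner_add_right sgn_div_norm inner_commute)
    qed
    moreover have "sgn d \<bullet> d > 0" using d0 by (simp add: sgn_div_norm dot_square_norm)
    ultimately show False by linarith
  qed
  then show thesis using that[of l] by (simp add: d_def)
qed

text \<open>Lower semicontinuity of Voronoi cells at a nonsingular point. A point \<open>y\<close> of the cell of \<open>p\<close> is
  \<open>p + l * G p\<close>, where \<open>G\<close> is the gradient; since \<open>p\<close> minimizes the distance to \<open>y\<close>, the second-order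
  condition on tangent directions \<open>w\<close> reads \<open>- 2 * l * H p w \<le> 1\<close>. For \<open>t < 1\<close> the same condition
  for \<open>t * l\<close> is strict, hence stable under moving the base point.\<close>

lemma voronoi_cell_lower_semicontinuous:
  fixes f :: "'a::euclidean_space \<Rightarrow> real"
  assumes f: "real_polynomial_function f" and X: "compact X" and p: "p \<in> X"
    and nz: "frechet_derivative f (at p) \<noteq> (\<lambda>_. 0)"
    and U: "open U" "p \<in> U" "X \<inter> U = {x \<in> U. f x = 0}"
    and y: "y \<in> voronoi_cell X p" and t: "0 \<le> t" "t < 1"
    and a: "\<And>n. a n \<in> X" "a \<longlonglongrightarrow> p"
  obtains b :: "nat \<Rightarrow> 'a" where "b \<longlonglongrightarrow> p + t *\<^sub>R (y - p)" "\<forall>\<^sub>F n in sequentially. b n \<in> voronoi_cell X (a n)"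
proof -
  obtain G H where G: "continuous_on UNIV G" and der: "\<And>x. (f has_derivative (\<lambda>v. G x \<bullet> v)) (at x)"
    and H': "\<forall>x a p w. x \<longlonglongrightarrow> p \<longrightarrow> a \<longlonglongrightarrow> p \<longrightarrow> (\<forall>n. x n \<noteq> a n) \<longrightarrow> (\<lambda>n::nat. sgn (x n - a n)) \<longlonglongrightarrow> w \<longrightarrow>
      (\<lambda>n. (f (x n) - f (a n) - G (a n) \<bullet> (x n - a n)) / (norm (x n - a n))\<^sup>2) \<longlonglongrightarrow> H p w"
    using polynomial_secant_expansion[OF f] by blast
  have H: "(\<lambda>n. (f (x n) - f (a n) - G (a n) \<bullet> (x n - a n)) / (norm (x n - a n))\<^sup>2) \<longlonglongrightarrow> H p w"
    if "x \<longlonglongrightarrow> p" "a \<longlonglongrightarrow> p" "\<And>n. x n \<noteq> a n" "(\<lambda>n::nat. sgn (x n - a n)) \<longlonglongrightarrow> w" for x a p w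
    using H'[rule_format, OF that(1,2) _ that(4)] that(3) by blast
  have cont: "continuous_on UNIV f"
    using der by (meson has_derivative_continuous continuous_at_imp_continuous_on)
  have Gp: "G p \<noteq> 0"
    using nz frechet_derivative_at[OF der[of p]] by auto
  have fp: "f p = 0" using p U by blast
  obtain l where l: "y - p = l *\<^sub>R G p"
    using voronoi_cell_subset_normal[OF cont der Gp p U y] .
  have second_order: "- 2 * l * H p w \<le> 1" if w: "norm w = 1" "G p \<bullet> w = 0" for w
  proof -
    obtain x :: "nat \<Rightarrow> 'a" where x: "x \<longlonglongrightarrow> p" "\<And>n. x n \<noteq> p" "\<And>n. f (x n) = 0" "(\<lambda>n. sgn (x n - p)) \<longlonglongrightarrow> w"
      using zero_set_tangent_sequence[OF cont der fp Gp w] by metis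
    have "(\<lambda>n. (f (x n) - f p - G p \<bullet> (x n - p)) / (norm (x n - p))\<^sup>2) \<longlonglongrightarrow> H p w"
      by (rule H[of x p "\<lambda>n. p"]) (use x in auto)
    then have "(\<lambda>n. - 2 * l * ((f (x n) - f p - G p \<bullet> (x n - p)) / (norm (x n - p))\<^sup>2)) \<longlonglongrightarrow> - 2 * l * H p w"
      by (intro tendsto_intros)
    moreover have "\<forall>\<^sub>F n in sequentially. - 2 * l * ((f (x n) - f p - G p \<bullet> (x n - p)) / (norm (x n - p))\<^sup>2) \<le> 1"
      using eventually_in_zero_set[OF U x(1,3)]
    proof eventually_elim
      case (elim n)
      then have "2 * ((x n - p) \<bullet> (y - p)) \<le> (norm (x n - p))\<^sup>2"
        using y voronoi_cell_iff by blast
      then have "2 * l * (G p \<bullet> (x n - p)) \<le> (norm (x n - p))\<^sup>2"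
        by (simp add: l inner_commute)
      then show ?case using x(2)[of n] by (simp add: x(3) fp divide_le_eq)
    qed
    ultimately show ?thesis by (rule tendsto_upperbound) simp
  qed
  define m where "m = t * l"
  \<comment> \<open>The offset follows the gradient at the moving base point.\<close>
  define b where "b = (\<lambda>n. a n + m *\<^sub>R G (a n))"
  have Ga: "(\<lambda>n. G (s n)) \<longlonglongrightarrow> G p" if "s \<longlonglongrightarrow> p" for s
    using continuous_on_tendsto_compose[OF G that] by simp
  have "b \<longlonglongrightarrow> p + m *\<^sub>R G p"
    unfolding b_def by (intro tendsto_intros a(2) Ga)
  then have "b \<longlonglongrightarrow> p + t *\<^sub>R (y - p)" by (simp add: m_def l)
  moreover have "\<forall>\<^sub>F n in sequentially. b n \<in> voronoi_cell X (a n)"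
  proof (rule ccontr)
    assume "\<not> ?thesis"
    from not_eventually_sequentially_subseq[OF this]
    obtain r :: "nat \<Rightarrow> nat" where r: "strict_mono r" "\<And>n. b (r n) \<notin> voronoi_cell X (a (r n))"
      by blast
    have "\<exists>x\<in>X. (norm (x - a (r n)))\<^sup>2 < 2 * m * ((x - a (r n)) \<bullet> G (a (r n)))" for n
      using r(2)[of n] by (auto simp: voronoi_cell_iff b_def not_le mult.assoc)
    then obtain x where x: "\<And>n. x n \<in> X"
      "\<And>n. (norm (x n - a (r n)))\<^sup>2 < 2 * m * ((x n - a (r n)) \<bullet> G (a (r n)))" by metis
    have xa: "x n \<noteq> a (r n)" for n using x(2)[of n] by auto
    obtain q s where s: "q \<in> X" "strict_mono s" "(x \<circ> s) \<longlonglongrightarrow> q"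
      using X x(1) unfolding compact_def by blast
    have "seq_compact (sphere (0::'a) 1)" by (simp add: compact_imp_seq_compact)
    moreover have "\<forall>n. sgn (x (s n) - a (r (s n))) \<in> sphere (0::'a) 1"
      using xa by (simp add: norm_sgn)
    ultimately obtain w s' where w: "w \<in> sphere (0::'a) 1" "strict_mono s'"
      "((\<lambda>n. sgn (x (s n) - a (r (s n)))) \<circ> s') \<longlonglongrightarrow> w"
      by (rule seq_compactE)
    define x' where "x' = (\<lambda>n. x (s (s' n)))"
    define a' where "a' = (\<lambda>n. a (r (s (s' n))))"
    have x': "x' \<longlonglongrightarrow> q"
      using LIMSEQ_subseq_LIMSEQ[OF s(3) w(2)] by (simp add: x'_def o_def)
    have "strict_mono (r \<circ> s \<circ> s')" using r(1) s(2) w(2) by (simp add: strict_mono_o)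
    then have a': "a' \<longlonglongrightarrow> p"
      using LIMSEQ_subseq_LIMSEQ[OF a(2)] by (fastforce simp: a'_def o_def)
    have w': "(\<lambda>n. sgn (x' n - a' n)) \<longlonglongrightarrow> w"
      using w(3) by (simp add: x'_def a'_def o_def)
    have less: "(norm (x' n - a' n))\<^sup>2 < 2 * m * ((x' n - a' n) \<bullet> G (a' n))" for n
      unfolding x'_def a'_def by (rule x(2))
    have neq: "x' n \<noteq> a' n" for n unfolding x'_def a'_def by (rule xa)
    \<comment> \<open>The limit of the violated inequalities contradicts the cell inequality of
      \<open>p\<close> scaled by \<open>t < 1\<close>, unless \<open>q = p\<close>. So violations
      can only come from points close to the base point.\<close>
    have "(norm (q - p))\<^sup>2 \<le> 2 * m * ((q - p) \<bullet> G p)"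
    proof (rule tendsto_le[OF sequentially_bot])
      show "(\<lambda>n. (norm (x' n - a' n))\<^sup>2) \<longlonglongrightarrow> (norm (q - p))\<^sup>2"
        by (intro tendsto_intros x' a')
      show "(\<lambda>n. 2 * m * ((x' n - a' n) \<bullet> G (a' n))) \<longlonglongrightarrow> 2 * m * ((q - p) \<bullet> G p)"
        by (intro tendsto_intros x' a' Ga)
    qed (auto intro: always_eventually less_imp_le less)
    also have "\<dots> = t * (2 * ((q - p) \<bullet> (y - p)))" by (simp add: m_def l)
    also have "\<dots> \<le> t * (norm (q - p))\<^sup>2"
      using y s(1) t by (intro mult_left_mono) (auto simp: voronoi_cell_iff)
    finally have "(1 - t) * (norm (q - p))\<^sup>2 \<le> 0" by (simp add: algebra_simps)
    then have "q = p" using t by (simp add: mult_le_0_iff)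
    then have x'p: "x' \<longlonglongrightarrow> p" using x' by simp
    have f0: "\<forall>\<^sub>F n in sequentially. f (x' n) = 0 \<and> f (a' n) = 0"
      using topological_tendstoD[OF x'p U(1,2)] topological_tendstoD[OF a' U(1,2)]
    proof eventually_elim
      case (elim n)
      moreover have "x' n \<in> X" "a' n \<in> X" using x(1) a(1) by (auto simp: x'_def a'_def)
      ultimately show ?case using U(3) by blast
    qed
    let ?Q = "\<lambda>n. (f (x' n) - f (a' n) - G (a' n) \<bullet> (x' n - a' n)) / (norm (x' n - a' n))\<^sup>2"
    have Q: "?Q \<longlonglongrightarrow> H p w"
      by (rule H[OF x'p a' neq w'])
    have norm0: "(\<lambda>n. norm (x' n - a' n)) \<longlonglongrightarrow> norm (p - p)"
      by (intro tendsto_intros x'p a')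
    \<comment> \<open>Since \<open>f\<close> vanishes at both ends of the secant, the gradient along
      the secant direction is the remainder times its length, up to sign. It tends to 0, so
      \<open>w\<close> is tangent and \<open>second_order\<close> applies.\<close>
    have "(\<lambda>n. - (?Q n * norm (x' n - a' n))) \<longlonglongrightarrow> - (H p w * norm (p - p))"
      by (intro tendsto_intros Q norm0)
    moreover have "\<forall>\<^sub>F n in sequentially. - (?Q n * norm (x' n - a' n)) = G (a' n) \<bullet> sgn (x' n - a' n)"
      using f0
    proof eventually_elim
      case (elim n)
      have "G (a' n) \<bullet> sgn d = (G (a' n) \<bullet> d) / norm d" for d
        by (simp add: sgn_div_norm divide_inverse mult.commute)
      then show ?case using elim neq[of n] by (simp add: power2_eq_square)
    qed
    ultimately have "(\<lambda>n. G (a' n) \<bullet> sgn (x' n - a' n)) \<longlonglongrightarrow> - (H p w * norm (p - p))"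
      by (rule Lim_transform_eventually)
    moreover have "(\<lambda>n. G (a' n) \<bullet> sgn (x' n - a' n)) \<longlonglongrightarrow> G p \<bullet> w"
      by (intro tendsto_intros Ga a' w')
    ultimately have "G p \<bullet> w = - (H p w * norm (p - p))" by (rule LIMSEQ_unique[rotated])
    then have "- 2 * l * H p w \<le> 1" using w(1) second_order by simp
    \<comment> \<open>The violated inequality divided by the squared secant length; with
      \<open>second_order\<close> it yields \<open>1 \<le> t\<close>.\<close>
    moreover have "1 \<le> - 2 * m * H p w"
    proof (rule tendsto_lowerbound)
      show "(\<lambda>n. - 2 * m * ?Q n) \<longlonglongrightarrow> - 2 * m * H p w"
        by (intro tendsto_intros Q)
      show "\<forall>\<^sub>F n in sequentially. 1 \<le> - 2 * m * ?Q n"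
        using f0
      proof eventually_elim
        case (elim n)
        then show ?case using less[of n] neq[of n] by (simp add: le_divide_eq inner_commute)
      qed
    qed simp
    moreover have "- 2 * m * H p w = t * (- 2 * l * H p w)" by (simp add: m_def)
    ultimately have "1 \<le> t * 1" using t mult_left_mono order_trans by metis
    then show False using t by simp
  qed
  ultimately show thesis by (rule that)
qed

text \<open>Bounded closed sets being compact, Kuratowski convergence suffices: \<open>upper\<close>
  keeps limits of points of the \<open>K n\<close> in \<open>L\<close>, and \<open>lower\<close>
  makes every point of \<open>L\<close> such a limit.\<close>

lemma wijsman_convergentI:
  fixes K :: "nat \<Rightarrow> 'a::euclidean_space set"
  assumes K: "\<And>n. closed (K n)" "\<And>n. K n \<noteq> {}" and L: "closed L" "L \<noteq> {}"
    and upper: "\<And>r y z. strict_mono (r :: nat \<Rightarrow> nat) \<Longrightarrow> (\<And>n. y n \<in> K (r n)) \<Longrightarrow> y \<longlonglongrightarrow> z \<Longrightarrow> z \<in> L"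
    and lower: "\<And>z d. z \<in> L \<Longrightarrow> 0 < d \<Longrightarrow> \<forall>\<^sub>F n in sequentially. infdist z (K n) < d"
  shows "wijsman_convergent K L"
proof -
  have "(\<lambda>n. infdist x (K n)) \<longlonglongrightarrow> infdist x L" for x
  proof (rule order_tendstoI)
    fix d assume d: "infdist x L < d"
    obtain z where z: "z \<in> L" "infdist x L = dist x z"
      using infdist_attains_inf[OF L] by blast
    show "\<forall>\<^sub>F n in sequentially. infdist x (K n) < d"
      using lower[OF z(1), of "d - dist x z"] d z(2)
      by (auto elim!: eventually_mono intro: le_less_trans[OF infdist_triangle[of x _ z]])
  next
    fix d assume d: "d < infdist x L"
    show "\<forall>\<^sub>F n in sequentially. d < infdist x (K n)"
    proof (rule ccontr)
      assume "\<not> ?thesis"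
      from not_eventually_sequentially_subseq[OF this]
      obtain r :: "nat \<Rightarrow> nat" where r: "strict_mono r" "\<And>n. \<not> d < infdist x (K (r n))"
        by blast
      have "\<exists>y\<in>K (r n). infdist x (K (r n)) = dist x y" for n
        using infdist_attains_inf[OF K] by metis
      then obtain y where y: "\<And>n. y n \<in> K (r n)" "\<And>n. infdist x (K (r n)) = dist x (y n)" by metis
      \<comment> \<open>The nearest points stay in a compact ball, so a subsequence converges to a
        point of \<open>L\<close> that is too close to \<open>x\<close>.\<close>
      have "y n \<in> cball x d" for n using r(2)[of n] y(2)[of n] by simp
      then obtain z s where s: "z \<in> cball x d" "strict_mono s" "(y \<circ> s) \<longlonglongrightarrow> z"
        using compact_cball unfolding compact_def by metis
      have "z \<in> L"
        by (rule upper[of "r \<circ> s" "y \<circ> s"]) (use r(1) s y(1) in \<open>auto simp: strict_mono_o\<close>)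
      then have "infdist x L \<le> dist x z" by (rule infdist_le)
      then show False using s(1) d by simp
    qed
  qed
  then show ?thesis using K L by (simp add: wijsman_convergent_def)
qed

lemma nonsingular_point_dim_tangent_space:
  assumes X: "real_algebraic_curve X" and p: "p \<in> X" "p \<notin> singular_points X"
  shows "algebraic_set X" "dim (tangent_space X p) = 1"
  using assms unfolding real_algebraic_curve_def real_variety_def singular_points_def
  by (auto simp: one_enat_def)

lemma voronoi_cells_wijsman:
  fixes X :: "(real^2) set"
  assumes X: "real_algebraic_curve X" "compact X" and e: "e \<longlonglongrightarrow> 0"
    and A: "\<And>n. A n \<subseteq> X" "\<And>n. singular_points X \<subseteq> A n"
      "\<And>n x. x \<in> X \<Longrightarrow> \<exists>a\<in>A n. dist x a \<le> e n"
    and p: "p \<in> X"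
  shows "\<exists>a. (\<forall>n. a n \<in> A n) \<and> wijsman_convergent (\<lambda>n. voronoi_cell (A n) (a n)) (voronoi_cell X p)"
proof -
  have approx: "\<exists>s. (\<forall>n. s n \<in> A n) \<and> s \<longlonglongrightarrow> x" if x: "x \<in> X" for x
  proof -
    obtain s where s: "\<And>n. s n \<in> A n" "\<And>n. dist x (s n) \<le> e n" using A(3)[OF x] by metis
    have "(\<lambda>n. dist (s n) x) \<longlonglongrightarrow> 0"
      by (rule Lim_null_comparison[OF _ e]) (use s(2) in \<open>simp add: dist_commute\<close>)
    then have "s \<longlonglongrightarrow> x" by (rule tendsto_dist_iff[THEN iffD2])
    then show ?thesis using s(1) by blast
  qed
  \<comment> \<open>No local equation is available at a singular point, but every sample contains
    it.\<close>
  obtain a where a: "\<And>n. a n \<in> A n" "a \<longlonglongrightarrow> p" "p \<in> singular_points X \<Longrightarrow> a = (\<lambda>_. p)"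
  proof (cases "p \<in> singular_points X")
    case True
    then show ?thesis using A(2) by (intro that[of "\<lambda>_. p"]) auto
  next
    case False
    obtain s where "\<forall>n. s n \<in> A n" "s \<longlonglongrightarrow> p" using approx[OF p] by blast
    then show ?thesis using False by (intro that[of s]) auto
  qed
  \<comment> \<open>Fewer competing points leave a larger cell.\<close>
  have sub: "voronoi_cell X q \<subseteq> voronoi_cell (A n) q" for q n
    using A(1) by (auto simp: voronoi_cell_def)
  have "wijsman_convergent (\<lambda>n. voronoi_cell (A n) (a n)) (voronoi_cell X p)"
  proof (rule wijsman_convergentI)
    show "voronoi_cell (A n) (a n) \<noteq> {}" for n
      by (auto simp: voronoi_cell_def intro!: exI[of _ "a n"])
    show "voronoi_cell X p \<noteq> {}"
      by (auto simp: voronoi_cell_def intro!: exI[of _ p])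
  next
    fix r :: "nat \<Rightarrow> nat" and y z
    assume r: "strict_mono r" and y: "\<And>n. y n \<in> voronoi_cell (A (r n)) (a (r n))" "y \<longlonglongrightarrow> z"
    show "z \<in> voronoi_cell X p"
      unfolding voronoi_cell_def
    proof (intro CollectI ballI)
      fix x assume "x \<in> X"
      then obtain s where s: "\<And>n. s n \<in> A n" "s \<longlonglongrightarrow> x" using approx by blast
      show "dist z p \<le> dist z x"
      proof (rule tendsto_le[OF sequentially_bot])
        show "(\<lambda>n. dist (y n) (s (r n))) \<longlonglongrightarrow> dist z x"
          using LIMSEQ_subseq_LIMSEQ[OF s(2) r] by (intro tendsto_dist y(2)) (simp add: o_def)
        show "(\<lambda>n. dist (y n) (a (r n))) \<longlonglongrightarrow> dist z p"
          using LIMSEQ_subseq_LIMSEQ[OF a(2) r] by (intro tendsto_dist y(2)) (simp add: o_def)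
        show "\<forall>\<^sub>F n in sequentially. dist (y n) (a (r n)) \<le> dist (y n) (s (r n))"
          using y(1) s(1) by (auto simp: voronoi_cell_def)
      qed
    qed
  next
    fix z and d :: real
    assume z: "z \<in> voronoi_cell X p" and d: "0 < d"
    show "\<forall>\<^sub>F n in sequentially. infdist z (voronoi_cell (A n) (a n)) < d"
    proof (cases "p \<in> singular_points X")
      case True
      then have "z \<in> voronoi_cell (A n) (a n)" for n using a(3) z sub by blast
      then show ?thesis using d by simp
    next
      case False
      obtain F U where F: "real_polynomial_function F" "open U" "p \<in> U" "X \<inter> U = {x \<in> U. F x = 0}"
        "tangent_space X p = {v. frechet_derivative F (at p) v = 0}"
        "frechet_derivative F (at p) \<noteq> (\<lambda>_. 0)"
        by (rule nonsingular_curve_locally_zero_set[OF nonsingular_point_dim_tangent_space(1)[OF X(1) p False] p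
              nonsingular_point_dim_tangent_space(2)[OF X(1) p False]])
      \<comment> \<open>The parameter \<open>t\<close> is so close to 1 that the shrunk point
        \<open>p + t *\<^sub>R (z - p)\<close> is within \<open>d\<close> of \<open>z\<close>; the
        summand 1 keeps \<open>K\<close> positive when \<open>z = p\<close>.\<close>
      define K where "K = norm (z - p) + 1"
      define m where "m = min (1/2) (d / (2 * K))"
      define t where "t = 1 - m"
      have K: "0 < K" "norm (z - p) \<le> K" unfolding K_def by (simp_all add: add_nonneg_pos)
      have m: "0 < m" "m \<le> 1/2" "m \<le> d / (2 * K)"
        using d K by (simp_all add: m_def)
      have t: "0 \<le> t" "t < 1" using m by (simp_all add: t_def)
      have "(1 - t) * norm (z - p) \<le> d / (2 * K) * K"
        using m K by (intro mult_mono) (auto simp: t_def)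
      also have "\<dots> < d" using d K by simp
      finally have tz: "(1 - t) * norm (z - p) < d" .
      have "a n \<in> X" for n using a(1) A(1) by blast
      then obtain b where b: "b \<longlonglongrightarrow> p + t *\<^sub>R (z - p)" "\<forall>\<^sub>F n in sequentially. b n \<in> voronoi_cell X (a n)"
        using voronoi_cell_lower_semicontinuous[OF F(1) X(2) p F(6,2,3,4) z t _ a(2)] by metis
      have "(\<lambda>n. dist z (b n)) \<longlonglongrightarrow> dist z (p + t *\<^sub>R (z - p))"
        by (intro tendsto_intros b(1))
      moreover have "dist z (p + t *\<^sub>R (z - p)) < d"
      proof -
        have "z - (p + t *\<^sub>R (z - p)) = (1 - t) *\<^sub>R (z - p)" by (simp add: algebra_simps)
        then show ?thesis using tz t by (simp only: dist_norm) simp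
      qed
      ultimately have "\<forall>\<^sub>F n in sequentially. dist z (b n) < d"
        by (rule order_tendstoD(2))
      then show ?thesis using b(2)
      proof eventually_elim
        case (elim n)
        then have "b n \<in> voronoi_cell (A n) (a n)" using sub by blast
        then show ?case using infdist_le elim(1) le_less_trans by metis
      qed
    qed
  qed (auto simp: closed_voronoi_cell)
  then show ?thesis using a(1) by blast
qed

text \<open>The center lies in the cell of \<open>p\<close>, so \<open>c - p\<close> is a multiple
  of the gradient, nonzero because \<open>r > 0\<close>. Hence the tangent line of the circle is the
  kernel of the derivative.\<close>

lemma voronoi_contact_tangent:
  fixes X :: "(real^2) set"
  assumes X: "real_algebraic_curve X" and p: "p \<in> X \<inter> sphere c r" and r: "r > 0"
    and c: "c \<in> voronoi_cell X p"
  shows "p \<in> circle_tangency_points X c r"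
proof (cases "p \<in> singular_points X")
  case True
  then show ?thesis using p by (simp add: circle_tangency_points_def)
next
  case False
  have pX: "p \<in> X" using p by simp
  obtain F U where F: "real_polynomial_function F" "open U" "p \<in> U" "X \<inter> U = {x \<in> U. F x = 0}"
    and T: "tangent_space X p = {v. frechet_derivative F (at p) v = 0}"
    and nz: "frechet_derivative F (at p) \<noteq> (\<lambda>_. 0)"
    by (rule nonsingular_curve_locally_zero_set[OF nonsingular_point_dim_tangent_space(1)[OF X pX False] pX
          nonsingular_point_dim_tangent_space(2)[OF X pX False]])
  obtain G where der: "\<And>x. (F has_derivative (\<lambda>v. G x \<bullet> v)) (at x)"
    using polynomial_secant_expansion[OF F(1)] by blast
  have DF: "frechet_derivative F (at p) = (\<lambda>v. G p \<bullet> v)"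
    using frechet_derivative_at[OF der] by simp
  then have Gp: "G p \<noteq> 0" using nz by auto
  have "continuous_on UNIV F"
    using der by (meson has_derivative_continuous continuous_at_imp_continuous_on)
  then obtain l where l: "c - p = l *\<^sub>R G p"
    using voronoi_cell_subset_normal[OF _ der Gp pX F(2-4) c] by metis
  have "l \<noteq> 0" using l p r by auto
  moreover have "p - c = (- l) *\<^sub>R G p" using l by (metis minus_diff_eq scaleR_minus_left)
  ultimately have "v \<bullet> (p - c) = 0 \<longleftrightarrow> G p \<bullet> v = 0" for v
    by (simp add: inner_commute)
  then show ?thesis using p by (simp add: circle_tangency_points_def T DF)
qed

section \<open>Approximation of Delaunay cells\<close>

text \<open>The closed \<open>d\<close>-neighborhood of a convex hull is a Minkowski sum with a
  ball, hence convex, and contains a hull as soon as it contains the generating points.\<close>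

lemma hausdorff_distance_convex_hull_le:
  fixes S T :: "'a::euclidean_space set"
  assumes S: "S \<noteq> {}" "\<And>s. s \<in> S \<Longrightarrow> \<exists>t\<in>T. dist s t \<le> d"
    and T: "T \<noteq> {}" "\<And>t. t \<in> T \<Longrightarrow> \<exists>s\<in>S. dist t s \<le> d"
  shows "hausdorff_distance (convex hull S) (convex hull T) \<le> d"
proof -
  have *: "infdist x (convex hull B) \<le> d"
    if AB: "\<And>a. a \<in> A \<Longrightarrow> \<exists>b\<in>B. dist a b \<le> d" and x: "x \<in> convex hull A" for A B :: "'a set" and x
  proof -
    let ?N = "\<Union>b\<in>convex hull B. \<Union>v\<in>cball 0 d. {b + v}"
    have "A \<subseteq> ?N"
    proof
      fix a assume "a \<in> A"
      then obtain b where b: "b \<in> B" "dist a b \<le> d" using AB by blast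
      then have "b \<in> convex hull B" "a - b \<in> cball 0 d" "a = b + (a - b)"
        by (auto simp: hull_inc dist_norm norm_minus_commute)
      then show "a \<in> ?N" by blast
    qed
    moreover have "convex ?N" by (intro convex_sums convex_convex_hull convex_cball)
    ultimately have "x \<in> ?N" using x hull_minimal by blast
    then obtain b v where b: "b \<in> convex hull B" "v \<in> cball 0 d" "x = b + v" by blast
    then have "dist x b \<le> d" by (simp add: dist_norm)
    then show ?thesis using b(1) infdist_le order_trans by blast
  qed
  have "(SUP x\<in>convex hull S. infdist x (convex hull T)) \<le> d"
    by (rule cSUP_least) (use S(1) *[OF S(2)] in auto)
  moreover have "(SUP x\<in>convex hull T. infdist x (convex hull S)) \<le> d"
    by (rule cSUP_least) (use T(1) *[OF T(2)] in auto)
  ultimately show ?thesis by (simp add: hausdorff_distance_def)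
qed

section \<open>Geometry of the contact set and its barycenter\<close>

text \<open>The perpendicular \<open>u\<close> from the affine hull of the other points to
  \<open>p\<close> has constant inner product with that hull, and the barycenter \<open>q\<close>
  lies strictly on the side of \<open>p\<close>. Projecting \<open>u\<close> to the direction space
  keeps all products with \<open>s - q\<close>.\<close>

lemma affine_independent_separating_direction:
  fixes S :: "'a::euclidean_space set"
  assumes S: "finite S" "\<not> affine_dependent S" "p \<in> S" and q: "(\<Sum>s\<in>S. s - q) = 0"
  shows "\<exists>w\<in>span ((\<lambda>s. s - q) ` S). \<forall>s\<in>S - {p}. w \<bullet> (s - q) < 0"
proof (cases "S = {p}")
  case True
  then show ?thesis by (auto intro!: bexI[of _ 0] span_zero)
next
  case False
  let ?W = "span ((\<lambda>s. s - q) ` S)"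
  let ?H = "affine hull (S - {p})"
  have ne: "?H \<noteq> {}" using False S(3) by auto
  have pH: "p \<notin> ?H" using S(2,3) affine_dependent_def by blast
  define b where "b = closest_point ?H p"
  have bH: "b \<in> ?H" unfolding b_def by (rule closest_point_in_set[OF closed_affine_hull ne])
  define u where "u = p - b"
  have u0: "u \<noteq> 0" using bH pH by (auto simp: u_def)
  have orth: "u \<bullet> (s - b) = 0" if s: "s \<in> ?H" for s
  proof -
    have le: "u \<bullet> (x - b) \<le> 0" if "x \<in> ?H" for x
      unfolding u_def b_def
      by (rule closest_point_dot[OF affine_imp_convex[OF affine_affine_hull] closed_affine_hull that])
    \<comment> \<open>The reflection of \<open>s\<close> in \<open>b\<close> stays in the hull and
      turns the closest-point inequality into an equation.\<close>
    have "2 *\<^sub>R b + (-1) *\<^sub>R s \<in> ?H"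
      by (rule mem_affine[OF affine_affine_hull bH s]) simp
    from le[OF this] have "u \<bullet> (b - s) \<le> 0" by (simp add: scaleR_2 algebra_simps)
    then show ?thesis using le[OF s] by (simp add: inner_diff_right)
  qed
  have "0 = u \<bullet> (\<Sum>s\<in>S. s - q)" using q by simp
  also have "\<dots> = (\<Sum>s\<in>S. u \<bullet> (s - b) - u \<bullet> (q - b))"
    by (simp add: inner_sum_right inner_diff_right)
  also have "\<dots> = (\<Sum>s\<in>S. u \<bullet> (s - b)) - card S * (u \<bullet> (q - b))"
    by (simp add: sum_subtractf)
  also have "(\<Sum>s\<in>S. u \<bullet> (s - b)) = u \<bullet> (p - b) + (\<Sum>s\<in>S - {p}. u \<bullet> (s - b))"
    using S by (simp add: sum.remove)
  also have "(\<Sum>s\<in>S - {p}. u \<bullet> (s - b)) = 0"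
    by (rule sum.neutral) (simp add: orth hull_inc)
  finally have "card S * (u \<bullet> (q - b)) = u \<bullet> u" by (simp add: u_def)
  then have "card S * (u \<bullet> (q - b)) > 0" using u0 by simp
  then have pos: "u \<bullet> (q - b) > 0" by (simp add: zero_less_mult_iff)
  have neg: "u \<bullet> (s - q) < 0" if "s \<in> S - {p}" for s
  proof -
    have "u \<bullet> (s - b) = 0" using that by (intro orth hull_inc)
    then show ?thesis using pos by (simp add: inner_diff_right)
  qed
  obtain w z where wz: "w \<in> ?W" "\<And>x. x \<in> ?W \<Longrightarrow> orthogonal z x" "u = w + z"
    using orthogonal_subspace_decomp_exists[of "(\<lambda>s. s - q) ` S" u] by blast
  have "w \<bullet> (s - q) < 0" if "s \<in> S - {p}" for s
  proof -
    have "s - q \<in> ?W" using that by (intro span_base) auto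
    then have "z \<bullet> (s - q) = 0" using wz(2) by (auto simp: orthogonal_def)
    then show ?thesis using neg[OF that] by (simp add: wz(3) inner_add_left)
  qed
  then show ?thesis using wz(1) by blast
qed

text \<open>The sum \<open>h\<close> of absolute values is a norm on the direction space, hence at
  least \<open>h0 * norm v\<close>. As the signed products add up to 0, one of them must be positive
  of comparable size.\<close>

lemma barycentric_growth:
  fixes S :: "'a::euclidean_space set"
  assumes S: "finite S" "S \<noteq> {}" and q: "(\<Sum>s\<in>S. s - q) = 0"
  shows "\<exists>k>0. \<forall>v\<in>span ((\<lambda>s. s - q) ` S). \<exists>s\<in>S. k * norm v \<le> v \<bullet> (s - q)"
proof -
  let ?W = "span ((\<lambda>s. s - q) ` S)"
  define h where "h = (\<lambda>v. \<Sum>s\<in>S. \<bar>v \<bullet> (s - q)\<bar>)"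
  have hpos: "h v > 0" if v: "v \<in> ?W" "v \<noteq> 0" for v
  proof (rule ccontr)
    assume "\<not> ?thesis"
    moreover have "h v \<ge> 0" unfolding h_def by (rule sum_nonneg) simp
    ultimately have "h v = 0" by simp
    then have "\<forall>s\<in>S. v \<bullet> (s - q) = 0"
      unfolding h_def using S(1) by (simp add: sum_nonneg_eq_0_iff)
    then have "orthogonal v x" if "x \<in> (\<lambda>s. s - q) ` S" for x
      using that by (auto simp: orthogonal_def)
    then have "orthogonal v v" by (rule orthogonal_to_span[OF v(1)])
    then show False using v(2) by (simp add: orthogonal_self)
  qed
  obtain h0 where h0: "0 < h0" "\<And>v. v \<in> ?W \<Longrightarrow> h0 * norm v \<le> h v"
  proof (cases "?W \<inter> sphere 0 1 = {}")
    case True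
    have zero: "v = 0" if "v \<in> ?W" for v
    proof (rule ccontr)
      assume "v \<noteq> 0"
      then have "sgn v \<in> ?W \<inter> sphere 0 1" using that by (simp add: norm_sgn sgn_div_norm span_scale)
      then show False using True by blast
    qed
    show ?thesis by (intro that[of 1]) (auto simp: h_def dest!: zero)
  next
    case False
    have "compact (?W \<inter> sphere 0 1)"
      by (intro closed_Int_compact closed_span compact_sphere)
    moreover have "continuous_on (?W \<inter> sphere 0 1) h"
      unfolding h_def by (intro continuous_intros)
    ultimately obtain v0 where v0: "v0 \<in> ?W \<inter> sphere 0 1" "\<And>v. v \<in> ?W \<inter> sphere 0 1 \<Longrightarrow> h v0 \<le> h v"
      using continuous_attains_inf[OF _ False] by metis
    show ?thesis
    proof (rule that[of "h v0"])
      show "0 < h v0" using v0(1) by (intro hpos) auto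
      fix v assume v: "v \<in> ?W"
      show "h v0 * norm v \<le> h v"
      proof (cases "v = 0")
        case True
        then show ?thesis by (simp add: h_def)
      next
        case False
        have "sgn v \<in> ?W \<inter> sphere 0 1" using v False by (simp add: norm_sgn sgn_div_norm span_scale)
        then have "h v0 * norm v \<le> h (sgn v) * norm v" using v0(2) by (intro mult_right_mono) auto
        also have "\<dots> = h v"
          using False by (simp add: h_def sgn_div_norm abs_mult sum_distrib_left[symmetric])
        finally show ?thesis .
      qed
    qed
  qed
  define N where "N = real (card S)"
  have N: "1 \<le> N" using S by (simp add: N_def Suc_leI card_gt_0_iff)
  \<comment> \<open>If all products were below \<open>k * norm v\<close>, zero sum would bound each
    absolute value by \<open>N * (k * norm v)\<close>, and so \<open>h v\<close> by half of
    \<open>h0 * norm v\<close>.\<close>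
  define k where "k = h0 / (2 * N * N)"
  have k: "0 < k" using h0 N by (simp add: k_def)
  have "\<exists>s\<in>S. k * norm v \<le> v \<bullet> (s - q)" if v: "v \<in> ?W" for v
  proof (rule ccontr)
    assume "\<not> ?thesis"
    then have less: "v \<bullet> (s - q) < k * norm v" if "s \<in> S" for s using that by force
    have v0: "v \<noteq> 0" using less S(2) by auto
    have sum0: "(\<Sum>s\<in>S. v \<bullet> (s - q)) = 0"
      using q by (simp add: inner_sum_right[symmetric])
    have "\<bar>v \<bullet> (s - q)\<bar> \<le> N * (k * norm v)" if s: "s \<in> S" for s
    proof -
      have "- (v \<bullet> (s - q)) = (\<Sum>s\<in>S - {s}. v \<bullet> (s - q))"
        using sum0 S(1) s by (simp add: sum.remove)
      also have "\<dots> \<le> real (card (S - {s})) * (k * norm v)"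
        using less by (intro sum_bounded_above) (auto intro: less_imp_le)
      also have "\<dots> \<le> N * (k * norm v)"
        using S(1) k by (intro mult_right_mono) (auto simp: N_def card_Diff1_le)
      finally have "- (v \<bullet> (s - q)) \<le> N * (k * norm v)" .
      moreover have "v \<bullet> (s - q) \<le> N * (k * norm v)"
      proof -
        have "1 * (k * norm v) \<le> N * (k * norm v)" by (rule mult_right_mono[OF N]) (use k in simp)
        then show ?thesis using less[OF s] by linarith
      qed
      ultimately show ?thesis by simp
    qed
    then have "h v \<le> N * (N * (k * norm v))"
      unfolding h_def N_def by (intro sum_bounded_above) auto
    also have "\<dots> = h0 * norm v / 2" using N by (simp add: k_def)
    finally have "h0 * norm v \<le> h0 * norm v / 2" using h0(2)[OF v] by linarith
    then show False using h0(1) v0 by simp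
  qed
  then show ?thesis using k by blast
qed

text \<open>Only three points need an argument: if collinear, one would lie strictly between the
  others, hence closer to the center than one of them.\<close>

lemma circle_points_affine_independent:
  fixes S :: "'a::euclidean_space set"
  assumes S: "S \<subseteq> sphere c r" "finite S" "card S < 4"
  shows "\<not> affine_dependent S"
proof -
  consider "card S = 0" | "card S = 1" | "card S = 2" | "card S = 3" using S(3) by linarith
  then show ?thesis
  proof cases
    case 1
    then show ?thesis using S(2) by (simp add: affine_dependent_def)
  next
    case 2
    then show ?thesis by (auto simp: card_1_singleton_iff)
  next
    case 3
    then show ?thesis by (auto simp: card_2_iff)
  next
    case 4
    then obtain x y z where xyz: "S = {x, y, z}" "x \<noteq> y" "x \<noteq> z" "y \<noteq> z"
      by (auto simp: card_3_iff)
    have nb: "\<not> between (b, c') a" if "a \<in> S" "b \<in> S" "c' \<in> S" "a \<noteq> b" "a \<noteq> c'" for a b c'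
    proof
      assume "between (b, c') a"
      then have "a \<in> open_segment b c'"
        using that by (simp add: between_mem_segment open_segment_def)
      from dist_decreases_open_segment[OF this, of c] show False
        using that S(1) by (auto simp: subset_iff)
    qed
    have "\<not> collinear {x, y, z}"
      unfolding collinear_between_cases using nb xyz by auto
    then show ?thesis using xyz collinear_3_eq_affine_dependent by blast
  qed
qed

text \<open>For \<open>q\<close> the barycenter of the contact set \<open>S\<close>, maximize \<open>F y = (infdist y A)\<^sup>2 - (dist y q)\<^sup>2\<close> over
  the points of \<open>c + W\<close> near \<open>c\<close>, where \<open>W\<close> is the direction space of the affine hull of \<open>S\<close>. With \<open>X\<close> in
  place of \<open>A\<close> the maximum is attained exactly at \<open>c\<close>, with linear decay, so the maximizer for \<open>A\<close> is an
  interior one. If the disc around it missed the part of \<open>A\<close> near some \<open>p \<in> S\<close>, then \<open>F\<close> would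
  increase in the direction \<open>w p\<close> that separates \<open>q\<close> from \<open>S - {p}\<close>.\<close>

lemma delaunay_cell_approximation:
  fixes X :: "'a::euclidean_space set"
  assumes X: "compact X" and r: "r > 0" and insc: "X \<inter> ball c r = {}"
    and S: "S = X \<inter> sphere c r" "S \<noteq> {}" "\<not> affine_dependent S"
    and e: "e \<longlonglongrightarrow> 0" "\<And>n. e n > 0"
    and A: "\<And>n. finite (A n)" "\<And>n. A n \<subseteq> X" "\<And>n x. x \<in> X \<Longrightarrow> \<exists>a\<in>A n. dist x a \<le> e n"
    and d: "d > 0"
  shows "\<forall>\<^sub>F n in sequentially. \<exists>E\<in>delaunay_cells (A n). E \<noteq> {} \<and> hausdorff_distance (convex hull S) E \<le> d"
proof -
  have finS: "finite S" using S(3) aff_independent_finite by blast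
  define q where "q = (1 / real (card S)) *\<^sub>R (\<Sum>s\<in>S. s)"
  have q: "(\<Sum>s\<in>S. s - q) = 0"
    using finS S(2) by (simp add: q_def sum_subtractf scaleR_conv_of_real sum_constant_scaleR)
  let ?W = "span ((\<lambda>s. s - q) ` S)"
  obtain k where k: "0 < k" "\<And>v. v \<in> ?W \<Longrightarrow> \<exists>s\<in>S. k * norm v \<le> v \<bullet> (s - q)"
    using barycentric_growth[OF finS S(2) q] by blast
  have "\<forall>p\<in>S. \<exists>w\<in>?W. \<forall>s\<in>S - {p}. w \<bullet> (s - q) < 0"
    using affine_independent_separating_direction[OF finS S(3) _ q] by blast
  then obtain w where w: "\<And>p. p \<in> S \<Longrightarrow> w p \<in> ?W" "\<And>p s. p \<in> S \<Longrightarrow> s \<in> S - {p} \<Longrightarrow> w p \<bullet> (s - q) < 0"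
    by metis
  have Xr: "r \<le> dist c x" if "x \<in> X" for x using insc that by force
  have ev1: "\<forall>\<^sub>F \<delta> in at_right 0. \<forall>a\<in>ball s \<delta>. w p \<bullet> (a - q) < 0" if ps: "p \<in> S" "s \<in> S - {p}" for p s
  proof -
    have "open {a. w p \<bullet> (a - q) < 0}" by (intro open_Collect_less continuous_intros)
    then obtain \<delta> where \<delta>: "0 < \<delta>" "ball s \<delta> \<subseteq> {a. w p \<bullet> (a - q) < 0}"
      using w(2)[OF ps] open_contains_ball by blast
    show ?thesis
      unfolding eventually_at_right_field
    proof (intro exI[of _ \<delta>] conjI allI impI ballI)
      fix \<delta>' a assume "\<delta>' < \<delta>" "a \<in> ball s \<delta>'"
      then have "a \<in> ball s \<delta>" by simp
      then show "w p \<bullet> (a - q) < 0" using \<delta>(2) by blast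
    qed (rule \<delta>)
  qed
  have ev2: "\<forall>\<^sub>F \<delta> in at_right 0. \<forall>p\<in>S. \<forall>s\<in>S - {p}. \<forall>a\<in>ball s \<delta>. w p \<bullet> (a - q) < 0"
    using finS ev1 by (intro eventually_ball_finite ballI) auto
  have ev3: "\<forall>\<^sub>F \<delta>::real in at_right 0. 0 < \<delta> \<and> \<delta> < d"
    using d eventually_at_right_real by force
  \<comment> \<open>The strict separation by the finitely many \<open>w p\<close> persists on small
    balls around the contact points.\<close>
  from eventually_happens'[OF trivial_limit_at_right_real eventually_conj[OF ev2 ev3]]
  obtain \<delta> where \<delta>: "0 < \<delta>" "\<delta> < d"
    "\<And>p s a. p \<in> S \<Longrightarrow> s \<in> S - {p} \<Longrightarrow> a \<in> ball s \<delta> \<Longrightarrow> w p \<bullet> (a - q) < 0"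
    by blast
  \<comment> \<open>By compactness, the part of \<open>X\<close> away from the contact points keeps
    a positive distance from the disc; half this gap serves as \<open>\<eta>\<close>.\<close>
  obtain \<eta> where \<eta>: "0 < \<eta>" "\<And>x. x \<in> X \<Longrightarrow> dist c x \<le> r + \<eta> \<Longrightarrow> \<exists>s\<in>S. x \<in> ball s \<delta>"
  proof (cases "X - (\<Union>s\<in>S. ball s \<delta>) = {}")
    case True
    show ?thesis
    proof (rule that[of 1])
      fix x assume "x \<in> X"
      then have "x \<in> (\<Union>s\<in>S. ball s \<delta>)" using True by blast
      then show "\<exists>s\<in>S. x \<in> ball s \<delta>" by blast
    qed simp
  next
    case False
    let ?Y = "X - (\<Union>s\<in>S. ball s \<delta>)"
    have "compact ?Y" using X by (intro compact_diff) auto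
    then obtain x0 where x0: "x0 \<in> ?Y" "\<And>x. x \<in> ?Y \<Longrightarrow> dist c x0 \<le> dist c x"
      using continuous_attains_inf[OF _ False continuous_on_dist[OF continuous_on_const continuous_on_id], of c]
      by blast
    have "x0 \<notin> S" using x0(1) \<delta>(1) by auto
    then have "dist c x0 \<noteq> r" using x0(1) S(1) by auto
    then have less: "r < dist c x0" using Xr[of x0] x0(1) by auto
    show ?thesis
    proof (rule that[of "(dist c x0 - r) / 2"])
      show "0 < (dist c x0 - r) / 2" using less by simp
      fix x assume x: "x \<in> X" "dist c x \<le> r + (dist c x0 - r) / 2"
      then have "x \<notin> ?Y" using x0(2)[of x] less by (auto simp: field_simps)
      then show "\<exists>s\<in>S. x \<in> ball s \<delta>" using x(1) by blast
    qed
  qed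
  \<comment> \<open>The bound \<open>\<eta> / 4\<close> keeps the points touching the new disc
    within \<open>r + \<eta>\<close> of \<open>c\<close>; the bound \<open>r / 2\<close> makes the
    new radius positive.\<close>
  define \<rho> where "\<rho> = min (\<eta> / 4) (r / 2)"
  have \<rho>: "0 < \<rho>" "\<rho> \<le> \<eta> / 4" "\<rho> \<le> r / 2" using \<eta>(1) r by (simp_all add: \<rho>_def)
  \<comment> \<open>The left side bounds the sampling error in squared distance, the right side is
    the decay at distance \<open>\<rho>\<close> from \<open>c\<close>.\<close>
  have "(\<lambda>n. 2 * e n * (r + \<rho>) + (e n)\<^sup>2) \<longlonglongrightarrow> 2 * 0 * (r + \<rho>) + 0\<^sup>2"
    by (intro tendsto_intros e)
  then have "\<forall>\<^sub>F n in sequentially. 2 * e n * (r + \<rho>) + (e n)\<^sup>2 < 2 * k * \<rho>"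
    by (rule order_tendstoD(2)) (use k \<rho> in simp)
  moreover have "\<forall>\<^sub>F n in sequentially. e n < \<eta> / 2"
    by (rule order_tendstoD(2)[OF e(1)]) (use \<eta> in simp)
  ultimately show ?thesis
  proof eventually_elim
    case (elim n)
    have An: "A n \<noteq> {}" using A(3) S by blast
    \<comment> \<open>Subtracting the squared distance to \<open>q\<close> cancels the quadratic
      part: \<open>F\<close> is a minimum of affine functions, one for each point of
      \<open>A n\<close>.\<close>
    define F where "F = (\<lambda>y. (infdist y (A n))\<^sup>2 - (dist y q)\<^sup>2)"
    define K where "K = (+) c ` (?W \<inter> cball 0 \<rho>)"
    have "compact K"
      unfolding K_def by (intro compact_translation closed_Int_compact closed_span compact_cball)
    moreover have cK: "c \<in> K" unfolding K_def using \<rho> by (auto intro!: image_eqI[of _ _ 0] span_zero)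
    moreover have "continuous_on K F" unfolding F_def by (intro continuous_intros)
    ultimately obtain y where y: "y \<in> K" "\<And>z. z \<in> K \<Longrightarrow> F z \<le> F y"
      using continuous_attains_sup[of K F] by blast
    then obtain v where v: "y = c + v" "v \<in> ?W" "norm v \<le> \<rho>" unfolding K_def by auto
    have near: "infdist z (A n) \<le> dist z s + e n" if s: "s \<in> S" for z s
    proof -
      obtain a where a: "a \<in> A n" "dist s a \<le> e n" using A(3) S(1) s by blast
      have "infdist z (A n) \<le> dist z a" by (rule infdist_le[OF a(1)])
      also have "\<dots> \<le> dist z s + dist s a" by (rule dist_triangle)
      finally show ?thesis using a(2) by simp
    qed
    have yS: "dist y s \<le> r + \<rho>" if "s \<in> S" for s
    proof -
      have "dist y s \<le> dist y c + dist c s" by (rule dist_triangle)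
      then show ?thesis using that v S(1) by (simp add: dist_norm)
    qed
    have Fc: "r\<^sup>2 - (dist c q)\<^sup>2 \<le> F c"
    proof -
      obtain a where a: "a \<in> A n" "infdist c (A n) = dist c a"
        using infdist_attains_inf[OF finite_imp_closed[OF A(1)] An] by blast
      have "r \<le> infdist c (A n)" using a A(2) Xr by auto
      then have "r\<^sup>2 \<le> (infdist c (A n))\<^sup>2" using r by (intro power_mono) auto
      then show ?thesis by (simp add: F_def)
    qed
    \<comment> \<open>At norm \<open>\<rho>\<close>, the contact point \<open>s\<close> from the
      growth estimate pushes \<open>F y\<close> below \<open>F c\<close>.\<close>
    have v_less: "norm v < \<rho>"
    proof (rule ccontr)
      assume "\<not> ?thesis"
      then have nv: "norm v = \<rho>" using v(3) by simp
      obtain s where s: "s \<in> S" "k * \<rho> \<le> v \<bullet> (s - q)" using k(2)[OF v(2)] nv by auto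
      have "(infdist y (A n))\<^sup>2 \<le> (dist y s + e n)\<^sup>2"
        by (rule power_mono[OF near[OF s(1)] infdist_nonneg])
      also have "\<dots> = (dist y s)\<^sup>2 + (2 * e n * dist y s + (e n)\<^sup>2)"
        by (simp add: power2_sum)
      also have "2 * e n * dist y s \<le> 2 * e n * (r + \<rho>)"
        using e(2)[of n] yS[OF s(1)] by (intro mult_left_mono) auto
      finally have "(infdist y (A n))\<^sup>2 < (dist y s)\<^sup>2 + 2 * k * \<rho>" using elim(1) by linarith
      moreover have "(dist y s)\<^sup>2 - (dist y q)\<^sup>2 = (dist c s)\<^sup>2 - (dist c q)\<^sup>2 - 2 * (v \<bullet> (s - q))"
        unfolding v(1) dist_norm power2_norm_eq_inner
        by (simp add: inner_add_left inner_add_right inner_diff_left inner_diff_right inner_commute)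
      moreover have "(dist c s)\<^sup>2 = r\<^sup>2" using s(1) S(1) by simp
      moreover have "2 * k * \<rho> = 2 * (k * \<rho>)" by simp
      ultimately have "F y < r\<^sup>2 - (dist c q)\<^sup>2" using s(2) unfolding F_def by linarith
      then show False using Fc y(2)[OF cK] by linarith
    qed
    define R where "R = infdist y (A n)"
    define T where "T = {a \<in> A n. dist y a = R}"
    have RA: "R \<le> dist y a" if "a \<in> A n" for a unfolding R_def by (rule infdist_le[OF that])
    obtain a0 where a0: "a0 \<in> A n" "R = dist y a0"
      unfolding R_def using infdist_attains_inf[OF finite_imp_closed[OF A(1)] An] by blast
    have Rpos: "R > 0"
    proof -
      have "dist c a0 \<le> dist c y + dist y a0" by (rule dist_triangle)
      moreover have "dist c y = norm v" by (simp add: v(1) dist_norm)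
      ultimately show ?thesis using Xr[of a0] a0 A(2)[of n] v_less \<rho> by auto
    qed
    have Rle: "R \<le> r + \<rho> + e n"
    proof -
      obtain s where "s \<in> S" using S(2) by blast
      then show ?thesis using near[of s y] yS[of s] by (simp add: R_def)
    qed
    have "a0 \<in> T" using a0 by (simp add: T_def)
    have T_near: "\<exists>s\<in>S. a \<in> ball s \<delta>" if a: "a \<in> T" for a
    proof (rule \<eta>(2))
      show "a \<in> X" using a A(2) by (auto simp: T_def)
      have "dist c a \<le> dist c y + dist y a" by (rule dist_triangle)
      moreover have "dist c y = norm v" by (simp add: v(1) dist_norm)
      ultimately show "dist c a \<le> r + \<eta>"
        using a Rle v_less \<rho> elim(2) by (simp add: T_def)
    qed
    have T_meets: "\<exists>a\<in>T. a \<in> ball p \<delta>" if p: "p \<in> S" for p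
    proof (rule ccontr)
      assume none: "\<not> ?thesis"
      \<comment> \<open>All touching points are then near contact points other than
        \<open>p\<close>.\<close>
      have neg: "w p \<bullet> (a - q) < 0" if a: "a \<in> T" for a
      proof -
        obtain s where s: "s \<in> S" "a \<in> ball s \<delta>" using T_near[OF a] by blast
        then have "s \<in> S - {p}" using none a by auto
        then show ?thesis using \<delta>(3)[OF p _ s(2)] by blast
      qed
      \<comment> \<open>Along \<open>w p\<close> the affine functions of touching points increase;
        those of the other points have slack at \<open>y\<close>, which survives small
        \<open>t\<close>.\<close>
      have expand: "(dist (y + t *\<^sub>R w p) a)\<^sup>2 - (dist (y + t *\<^sub>R w p) q)\<^sup>2 =
          (dist y a)\<^sup>2 - (dist y q)\<^sup>2 - 2 * t * (w p \<bullet> (a - q))" for t a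
        unfolding dist_norm power2_norm_eq_inner
        by (simp add: inner_add_left inner_add_right inner_diff_left inner_diff_right inner_commute algebra_simps)
      have "\<forall>\<^sub>F t in at_right 0. F y < (dist (y + t *\<^sub>R w p) a)\<^sup>2 - (dist (y + t *\<^sub>R w p) q)\<^sup>2"
        if a: "a \<in> A n" for a
      proof (cases "a \<in> T")
        case True
        have "F y = (dist y a)\<^sup>2 - (dist y q)\<^sup>2" using True by (simp add: F_def T_def R_def)
        then show ?thesis
          unfolding expand eventually_at_right_field using neg[OF True]
          by (intro exI[of _ 1]) (simp add: mult_pos_neg)
      next
        case False
        then have "R < dist y a" using RA[OF a] a by (simp add: T_def order_less_le)
        then have "R\<^sup>2 < (dist y a)\<^sup>2" using Rpos by (intro power_strict_mono) auto
        then have less: "F y < (dist y a)\<^sup>2 - (dist y q)\<^sup>2" by (simp add: F_def R_def)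
        have "((\<lambda>t. (dist y a)\<^sup>2 - (dist y q)\<^sup>2 - 2 * t * (w p \<bullet> (a - q))) \<longlongrightarrow>
            (dist y a)\<^sup>2 - (dist y q)\<^sup>2 - 2 * 0 * (w p \<bullet> (a - q))) (at_right 0)"
          by (intro tendsto_intros)
        then show ?thesis unfolding expand by (rule order_tendstoD(1)) (use less in simp)
      qed
      then have "\<forall>\<^sub>F t in at_right 0. \<forall>a\<in>A n. F y < (dist (y + t *\<^sub>R w p) a)\<^sup>2 - (dist (y + t *\<^sub>R w p) q)\<^sup>2"
        using A(1) by (intro eventually_ball_finite ballI) auto
      moreover have "\<forall>\<^sub>F t in at_right 0. norm (v + t *\<^sub>R w p) < \<rho>"
      proof -
        have "((\<lambda>t. norm (v + t *\<^sub>R w p)) \<longlongrightarrow> norm (v + 0 *\<^sub>R w p)) (at_right 0)"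
          by (intro tendsto_intros)
        then show ?thesis by (rule order_tendstoD(2)) (use v_less in simp)
      qed
      ultimately have "\<forall>\<^sub>F t in at_right (0::real). False"
      proof eventually_elim
        case (elim t)
        let ?z = "y + t *\<^sub>R w p"
        obtain a where "a \<in> A n" "infdist ?z (A n) = dist ?z a"
          using infdist_attains_inf[OF finite_imp_closed[OF A(1)] An] by blast
        then have "F y < F ?z" using elim(1) by (simp add: F_def)
        moreover have "?z \<in> K"
          unfolding K_def using elim(2) v w(1)[OF p]
          by (intro image_eqI[of _ _ "v + t *\<^sub>R w p"]) (auto simp: add.assoc intro!: span_add span_scale)
        ultimately show False using y(2)[of ?z] by simp
      qed
      then show False using eventually_happens'[OF trivial_limit_at_right_real] by blast
    qed
    show ?case
    proof (intro bexI conjI)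
      have "closure (ball y R) \<inter> A n = T"
        using Rpos RA by (force simp: T_def)
      moreover have "inscribed_disc (A n) (ball y R)"
        unfolding inscribed_disc_def using Rpos RA by (intro exI[of _ y] exI[of _ R]) force
      ultimately show "convex hull T \<in> delaunay_cells (A n)"
        unfolding delaunay_cells_def by blast
      show "convex hull T \<noteq> {}" using \<open>a0 \<in> T\<close> by auto
      show "hausdorff_distance (convex hull S) (convex hull T) \<le> d"
      proof (rule hausdorff_distance_convex_hull_le)
        show "T \<noteq> {}" using \<open>a0 \<in> T\<close> by auto
        show "\<exists>t\<in>T. dist s t \<le> d" if "s \<in> S" for s
          using T_meets[OF that] \<delta>(2) by force
        show "\<exists>s\<in>S. dist t s \<le> d" if "t \<in> T" for t
          using T_near[OF that] \<delta>(2) by (force simp: dist_commute)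
      qed (rule S)
    qed
  qed
qed

section \<open>Nonempty cells and the choice of the approximating sequence\<close>

text \<open>A disc around a point off \<open>X\<close> is enlarged until it touches
  \<open>X\<close>. Discs without contact give the empty cell, which is therefore never
  maximal.\<close>

lemma nonempty_delaunay_cell_exists:
  fixes X :: "'a::euclidean_space set"
  assumes X: "compact X" "X \<noteq> {}"
  shows "\<exists>E\<in>delaunay_cells X. E \<noteq> {}"
proof -
  have "X \<noteq> UNIV" using compact_imp_bounded[OF X(1)] not_bounded_UNIV by metis
  then obtain c where c: "c \<notin> X" by blast
  define r where "r = infdist c X"
  obtain x where x: "x \<in> X" "r = dist c x"
    unfolding r_def using infdist_attains_inf[OF compact_imp_closed[OF X(1)] X(2)] by blast
  have le: "r \<le> dist c y" if "y \<in> X" for y unfolding r_def by (rule infdist_le[OF that])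
  have r: "r > 0" using c x by auto
  have "inscribed_disc X (ball c r)"
    unfolding inscribed_disc_def using r le by (intro exI[of _ c] exI[of _ r]) force
  moreover have "x \<in> convex hull (closure (ball c r) \<inter> X)"
    using x r by (intro hull_inc) simp
  ultimately show ?thesis unfolding delaunay_cells_def by blast
qed

lemma compact_delaunay_cell:
  assumes "finite A" "E \<in> delaunay_cells A"
  shows "compact E"
  using assms unfolding delaunay_cells_def by (auto intro!: finite_imp_compact_convex_hull)

lemma hausdorff_distance_nonneg:
  assumes "compact K" "K \<noteq> {}"
  shows "0 \<le> hausdorff_distance K L"
proof -
  obtain x where x: "x \<in> K" using assms by blast
  have "bdd_above ((\<lambda>x. infdist x L) ` K)"
    by (intro bounded_imp_bdd_above compact_imp_bounded compact_continuous_image assms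
        continuous_intros)
  then have "infdist x L \<le> (SUP x\<in>K. infdist x L)" using x by (intro cSUP_upper)
  then show ?thesis using infdist_nonneg[of x L] unfolding hausdorff_distance_def by linarith
qed

text \<open>Choosing for each \<open>n\<close> an element within \<open>1 / (n + 1)\<close> of the
  infimum handles all \<open>d\<close> at once.\<close>

lemma exists_null_sequence:
  fixes f :: "'a \<Rightarrow> real"
  assumes ex: "\<And>n. \<exists>E. P n E" and nonneg: "\<And>n E. P n E \<Longrightarrow> 0 \<le> f E"
    and ev: "\<And>d. 0 < d \<Longrightarrow> \<forall>\<^sub>F n in sequentially. \<exists>E. P n E \<and> f E \<le> d"
  shows "\<exists>E. (\<forall>n. P n (E n)) \<and> (\<lambda>n. f (E n)) \<longlonglongrightarrow> 0"
proof -
  define h where "h = (\<lambda>n. Inf (f ` {E. P n E}))"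
  have bdd: "bdd_below (f ` {E. P n E})" for n
    by (rule bdd_belowI[of _ 0]) (auto intro: nonneg)
  have "\<exists>E. P n E \<and> f E < h n + inverse (real (Suc n))" for n
  proof -
    have "Inf (f ` {E. P n E}) < h n + inverse (real (Suc n))" by (simp add: h_def)
    then show ?thesis using cInf_lessD[of "f ` {E. P n E}"] ex[of n] by auto
  qed
  then obtain E where E: "\<And>n. P n (E n)" "\<And>n. f (E n) < h n + inverse (real (Suc n))" by metis
  have "(\<lambda>n. f (E n)) \<longlonglongrightarrow> 0"
  proof (rule LIMSEQ_I)
    fix d :: real assume d: "0 < d"
    have "\<forall>\<^sub>F n in sequentially. inverse (real (Suc n)) < d / 2"
      by (rule order_tendstoD(2)[OF LIMSEQ_inverse_real_of_nat]) (use d in simp)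
    moreover have "\<forall>\<^sub>F n in sequentially. \<exists>E. P n E \<and> f E \<le> d / 2" by (rule ev) (use d in simp)
    ultimately have "\<forall>\<^sub>F n in sequentially. norm (f (E n) - 0) < d"
    proof eventually_elim
      case (elim n)
      then obtain E' where E': "P n E'" "f E' \<le> d / 2" by blast
      have "h n \<le> f E'" unfolding h_def using E'(1) bdd by (intro cInf_lower) auto
      then have "f (E n) < d" using E(2)[of n] E'(2) elim(1) by linarith
      then show ?case using nonneg[OF E(1)] by simp
    qed
    then show "\<exists>no. \<forall>n\<ge>no. norm (f (E n) - 0) < d" by (simp add: eventually_sequentially)
  qed
  then show ?thesis using E(1) by blast
qed

theorem theorem1:
  fixes X :: "(real^2) set"
    and e :: "nat \<Rightarrow> real"
    and A :: "nat \<Rightarrow> (real^2) set"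
  assumes "real_algebraic_curve X" and "compact X"
    and "\<And>n. e n > 0" and "decseq e" and "e \<longlonglongrightarrow> 0"
    and "\<And>n. finite (A n)" and "\<And>n. A n \<subseteq> X"
    and "\<And>n. singular_points X \<subseteq> A n"
    and "\<And>n x. x \<in> X \<Longrightarrow> \<exists>a\<in>A n. dist x a \<le> e n"
  shows "(\<forall>p\<in>X. \<exists>a. (\<forall>n. a n \<in> A n) \<and>
            wijsman_convergent (\<lambda>n. voronoi_cell (A n) (a n)) (voronoi_cell X p)) \<and>
         ((\<forall>c r. r > 0 \<longrightarrow>
             finite (circle_tangency_points X c r) \<and> card (circle_tangency_points X c r) < 4) \<longrightarrow>
          (\<forall>D. maximal_delaunay_cell X D \<longrightarrow>
             (\<exists>E. (\<forall>n. E n \<in> delaunay_cells (A n)) \<and> hausdorff_convergent E D)))"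
proof (intro conjI ballI impI allI)
  fix p assume "p \<in> X"
  then show "\<exists>a. (\<forall>n. a n \<in> A n) \<and>
      wijsman_convergent (\<lambda>n. voronoi_cell (A n) (a n)) (voronoi_cell X p)"
    by (intro voronoi_cells_wijsman[where e = e] assms)
next
  fix D
  assume few: "\<forall>c r. r > 0 \<longrightarrow>
      finite (circle_tangency_points X c r) \<and> card (circle_tangency_points X c r) < 4"
    and D: "maximal_delaunay_cell X D"
  have X: "X \<noteq> {}" using assms(1) by (auto simp: real_algebraic_curve_def real_variety_def)
  obtain c r where r: "r > 0" "X \<inter> ball c r = {}" "D = convex hull (closure (ball c r) \<inter> X)"
    using D unfolding maximal_delaunay_cell_def delaunay_cells_def inscribed_disc_def by auto
  define S where "S = X \<inter> sphere c r"
  have rX: "r \<le> dist c x" if "x \<in> X" for x using r(2) that by force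
  have "closure (ball c r) \<inter> X = S" using r(1) rX by (force simp: S_def)
  then have DS: "D = convex hull S" using r(3) by simp
  have "D \<noteq> {}"
    using D nonempty_delaunay_cell_exists[OF assms(2) X] unfolding maximal_delaunay_cell_def by auto
  then have "S \<noteq> {}" using DS by auto
  \<comment> \<open>The disc is inscribed, so its center lies in the Voronoi cell of every contact
    point; the tangency hypothesis then leaves at most three contact points.\<close>
  have "S \<subseteq> circle_tangency_points X c r"
  proof
    fix p assume p: "p \<in> S"
    then have "c \<in> voronoi_cell X p" using rX by (simp add: voronoi_cell_def S_def)
    then show "p \<in> circle_tangency_points X c r"
      using voronoi_contact_tangent[OF assms(1) _ r(1)] p by (simp add: S_def)
  qed
  then have "finite S" "card S < 4"
    using few r(1) finite_subset card_mono le_less_trans by metis+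
  then have aff: "\<not> affine_dependent S"
    by (intro circle_points_affine_independent[of S c r]) (auto simp: S_def)
  have cD: "compact D" using DS \<open>finite S\<close> finite_imp_compact_convex_hull by blast
  let ?P = "\<lambda>n E. E \<in> delaunay_cells (A n) \<and> E \<noteq> {}"
  have "\<exists>E. (\<forall>n. ?P n (E n)) \<and> (\<lambda>n. hausdorff_distance D (E n)) \<longlonglongrightarrow> 0"
  proof (rule exists_null_sequence)
    fix n
    have "A n \<noteq> {}" using X assms(9) by blast
    then show "\<exists>E. ?P n E"
      using nonempty_delaunay_cell_exists[OF finite_imp_compact[OF assms(6)]] by blast
  next
    fix d :: real assume d: "0 < d"
    show "\<forall>\<^sub>F n in sequentially. \<exists>E. ?P n E \<and> hausdorff_distance D E \<le> d"
      using delaunay_cell_approximation[OF assms(2) r(1,2) S_def \<open>S \<noteq> {}\<close> aff assms(5,3,6,7,9) d]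
      unfolding DS by (auto elim!: eventually_mono)
  qed (rule hausdorff_distance_nonneg[OF cD \<open>D \<noteq> {}\<close>])
  then show "\<exists>E. (\<forall>n. E n \<in> delaunay_cells (A n)) \<and> hausdorff_convergent E D"
    using compact_delaunay_cell[OF assms(6)] cD \<open>D \<noteq> {}\<close> unfolding hausdorff_convergent_def by blast
qed

end
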